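(* Let $\mathbb{M}^2=(\mathbb{R}^2,\|\cdot\|)$ be a strictly convex normed plane. If $K\subset\mathbb{M}^2$ is a set of $n$ points and $r\ge 1$, then the 2-center problem with constrained circles (of radii $r$ and $1$) centered at points of $K$ can be solved in $O(n^2)$ time.
   Context: $B(x,\lambda)=\{y:\|y-x\|\le\lambda\}$ is the closed disc with center $x$ and radius $\lambda>0$. The normed plane is strictly convex if its unit circle contains no non-degenerate line segment. The 2-center problem with constrained circles, for a finite set $K$ and fixed radii $r$ and $1$ with $r\ge1$, asks to find two closed discs, one of radius $r$ and one of radius $1$, whose centers belong to $K$ and whose union covers $K$, i.e. points $p,q\in K$ with $K\subset B(p,r)\cup B(q,1)$ (or to determine that no such pair exists). Running time is counted as the number of elementary operations, where the norm is fixed and the following are constant-time operations: arithmetic and comparison of real coordinates, evaluation of the norm, computing the intersection points of two circles of the same radius, computing the points of a circle at which its supporting lines of a fixed direction touch it, and comparing the positions of points along a circle. *)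

theory Defs
  imports "HOL-Analysis.Analysis" "HOL-Library.Landau_Symbols"
begin

section \<open>Strictly convex normed planes\<close>

type_synonym point = "real \<times> real"

text \<open>The norm of the plane is an arbitrary function \<open>N\<close> subject to the norm axioms; it is unrelated
  to the Euclidean norm that the product type carries by default.\<close>

locale normed_plane =
  fixes N :: "point \<Rightarrow> real"
  assumes zero_iff: "N x = 0 \<longleftrightarrow> x = 0"
    and scale: "N (a *\<^sub>R x) = \<bar>a\<bar> * N x"
    and triangle: "N (x + y) \<le> N x + N y"

locale strictly_convex_plane = normed_plane +
  assumes strictly_convex: "a \<noteq> b \<Longrightarrow> \<not> closed_segment a b \<subseteq> {x. N x = 1}"

definition disc :: "(point \<Rightarrow> real) \<Rightarrow> point \<Rightarrow> real \<Rightarrow> point set" where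
  "disc N x l = {y. N (y - x) \<le> l}"

definition circle :: "(point \<Rightarrow> real) \<Rightarrow> point \<Rightarrow> real \<Rightarrow> point set" where
  "circle N x l = {y. N (y - x) = l}"


section \<open>Geometric primitives\<close>

fun cross2 :: "point \<Rightarrow> point \<Rightarrow> real" where
  "cross2 (a, b) (c, d) = a * d - b * c"

text \<open>The points of a circle at which a line of direction \<open>d\<close> supports its disc: the line
  touches the disc and has it on one side.\<close>

definition touch_points :: "(point \<Rightarrow> real) \<Rightarrow> point \<Rightarrow> real \<Rightarrow> point \<Rightarrow> point set" where
  "touch_points N c l d = {z \<in> circle N c l.
     (\<forall>y\<in>disc N c l. cross2 d (y - z) \<ge> 0) \<or> (\<forall>y\<in>disc N c l. cross2 d (y - z) \<le> 0)}"

text \<open>The position of \<open>x\<close> when a circle with centre \<open>c\<close> is traversed counterclockwise from its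
  point \<open>s\<close>. Every ray from the centre meets the circle exactly once, so positions are ordered as the
  (Euclidean) angles at the centre.\<close>

fun to_complex :: "point \<Rightarrow> complex" where
  "to_complex (a, b) = Complex a b"

definition circle_position :: "point \<Rightarrow> point \<Rightarrow> point \<Rightarrow> real" where
  "circle_position c s x = Arg2pi (to_complex (x - c) / to_complex (s - c))"

text \<open>A primitive that returns a finite set of points delivers it in some unspecified order. An infinite
  set (intersection of a circle with itself, direction zero) yields no points.\<close>

definition enum_points :: "point set \<Rightarrow> point list" where
  "enum_points S = (if finite S then SOME ps. distinct ps \<and> set ps = S else [])"


section \<open>A real random access machine\<close>

text \<open>Programs are finite syntactic objects, independent of the input and of its size. There are two
  sorts of data: natural numbers, used for addressing and control, and exact reals. There is no conversion
  between the sorts (in particular no floor operation), index arithmetic is restricted to addition and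
  truncated subtraction, and the literals of a program are integers, so that no information is hidden in
  real constants.\<close>

datatype iexp =
    ICon nat
  | IVar string
  | IArr string iexp
  | IAdd iexp iexp
  | ISub iexp iexp

datatype rexp =
    RCon int
  | RVar string
  | RArr string iexp
  | RAdd rexp rexp
  | RSub rexp rexp
  | RMul rexp rexp
  | RDiv rexp rexp
  | RNorm rexp rexp

type_synonym pexp = "rexp \<times> rexp"

datatype bexp =
    ILe iexp iexp
  | RLe rexp rexp
  | BNot bexp
  | BAnd bexp bexp
  | CircleLe pexp pexp pexp pexp

text \<open>\<open>Inter k u v c1 c2 l\<close> computes the common points of the circles of radius \<open>l\<close> around
  \<open>c1\<close> and \<open>c2\<close>, and \<open>Touch k u v c l d\<close> the points at which the supporting lines of direction
  \<open>d\<close>, a literal, touch the circle of radius \<open>l\<close> around \<open>c\<close>. Both store the number of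
  points in \<open>k\<close> and their coordinates in the arrays \<open>u\<close> and \<open>v\<close>.\<close>

datatype com =
    Skip
  | ISet string iexp
  | RSet string rexp
  | IStore string iexp iexp
  | RStore string iexp rexp
  | Inter string string string pexp pexp rexp
  | Touch string string string pexp rexp "int \<times> int"
  | Seq com com
  | Cond bexp com com
  | While bexp com

record state =
  iv :: "string \<Rightarrow> nat"
  rv :: "string \<Rightarrow> real"
  ia :: "string \<Rightarrow> nat \<Rightarrow> nat"
  ra :: "string \<Rightarrow> nat \<Rightarrow> real"

fun ival :: "iexp \<Rightarrow> state \<Rightarrow> nat" where
  "ival (ICon n) s = n"
| "ival (IVar x) s = iv s x"
| "ival (IArr x e) s = ia s x (ival e s)"
| "ival (IAdd e f) s = ival e s + ival f s"
| "ival (ISub e f) s = ival e s - ival f s"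

fun rval :: "(point \<Rightarrow> real) \<Rightarrow> rexp \<Rightarrow> state \<Rightarrow> real" where
  "rval N (RCon n) s = of_int n"
| "rval N (RVar x) s = rv s x"
| "rval N (RArr x e) s = ra s x (ival e s)"
| "rval N (RAdd e f) s = rval N e s + rval N f s"
| "rval N (RSub e f) s = rval N e s - rval N f s"
| "rval N (RMul e f) s = rval N e s * rval N f s"
| "rval N (RDiv e f) s = rval N e s / rval N f s"
| "rval N (RNorm e f) s = N (rval N e s, rval N f s)"

fun pval :: "(point \<Rightarrow> real) \<Rightarrow> pexp \<Rightarrow> state \<Rightarrow> point" where
  "pval N (e, f) s = (rval N e s, rval N f s)"

fun bval :: "(point \<Rightarrow> real) \<Rightarrow> bexp \<Rightarrow> state \<Rightarrow> bool" where
  "bval N (ILe e f) s = (ival e s \<le> ival f s)"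
| "bval N (RLe e f) s = (rval N e s \<le> rval N f s)"
| "bval N (BNot b) s = (\<not> bval N b s)"
| "bval N (BAnd b b') s = (bval N b s \<and> bval N b' s)"
| "bval N (CircleLe c p x y) s =
     (circle_position (pval N c s) (pval N p s) (pval N x s)
        \<le> circle_position (pval N c s) (pval N p s) (pval N y s))"

text \<open>Running time: every constructor of an expression or a command counts as one operation each time
  it is evaluated or executed.\<close>

fun icost :: "iexp \<Rightarrow> nat" where
  "icost (ICon n) = 1"
| "icost (IVar x) = 1"
| "icost (IArr x e) = 1 + icost e"
| "icost (IAdd e f) = 1 + icost e + icost f"
| "icost (ISub e f) = 1 + icost e + icost f"

fun rcost :: "rexp \<Rightarrow> nat" where
  "rcost (RCon n) = 1"
| "rcost (RVar x) = 1"
| "rcost (RArr x e) = 1 + icost e"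
| "rcost (RAdd e f) = 1 + rcost e + rcost f"
| "rcost (RSub e f) = 1 + rcost e + rcost f"
| "rcost (RMul e f) = 1 + rcost e + rcost f"
| "rcost (RDiv e f) = 1 + rcost e + rcost f"
| "rcost (RNorm e f) = 1 + rcost e + rcost f"

fun pcost :: "pexp \<Rightarrow> nat" where
  "pcost (e, f) = rcost e + rcost f"

fun bcost :: "bexp \<Rightarrow> nat" where
  "bcost (ILe e f) = 1 + icost e + icost f"
| "bcost (RLe e f) = 1 + rcost e + rcost f"
| "bcost (BNot b) = 1 + bcost b"
| "bcost (BAnd b b') = 1 + bcost b + bcost b'"
| "bcost (CircleLe c p x y) = 1 + pcost c + pcost p + pcost x + pcost y"

definition store_points :: "string \<Rightarrow> string \<Rightarrow> string \<Rightarrow> point list \<Rightarrow> state \<Rightarrow> state" where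
  "store_points k u v ps s =
     s\<lparr>iv := (iv s)(k := length ps),
       ra := (ra s)
         (u := \<lambda>i. if i < length ps then fst (ps ! i) else ra s u i,
          v := \<lambda>i. if i < length ps then snd (ps ! i) else ra s v i)\<rparr>"

text \<open>\<open>exec N c s t s'\<close>: started in \<open>s\<close>, the program \<open>c\<close> terminates in \<open>s'\<close> after
  \<open>t\<close> operations.\<close>

inductive exec :: "(point \<Rightarrow> real) \<Rightarrow> com \<Rightarrow> state \<Rightarrow> nat \<Rightarrow> state \<Rightarrow> bool"
  for N :: "point \<Rightarrow> real" where
  Skip: "exec N Skip s 1 s"
| ISet: "exec N (ISet x e) s (1 + icost e) (s\<lparr>iv := (iv s)(x := ival e s)\<rparr>)"
| RSet: "exec N (RSet x e) s (1 + rcost e) (s\<lparr>rv := (rv s)(x := rval N e s)\<rparr>)"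
| IStore: "exec N (IStore x i e) s (1 + icost i + icost e)
    (s\<lparr>ia := (ia s)(x := (ia s x)(ival i s := ival e s))\<rparr>)"
| RStore: "exec N (RStore x i e) s (1 + icost i + rcost e)
    (s\<lparr>ra := (ra s)(x := (ra s x)(ival i s := rval N e s))\<rparr>)"
| Inter: "exec N (Inter k u v c1 c2 l) s (1 + pcost c1 + pcost c2 + rcost l)
    (store_points k u v
      (enum_points (circle N (pval N c1 s) (rval N l s) \<inter> circle N (pval N c2 s) (rval N l s))) s)"
| Touch: "exec N (Touch k u v c l (d1, d2)) s (1 + pcost c + rcost l)
    (store_points k u v
      (enum_points (touch_points N (pval N c s) (rval N l s) (of_int d1, of_int d2))) s)"
| Seq: "exec N c1 s t1 s' \<Longrightarrow> exec N c2 s' t2 s'' \<Longrightarrow> exec N (Seq c1 c2) s (1 + t1 + t2) s''"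
| CondTrue: "bval N b s \<Longrightarrow> exec N c1 s t s' \<Longrightarrow> exec N (Cond b c1 c2) s (1 + bcost b + t) s'"
| CondFalse: "\<not> bval N b s \<Longrightarrow> exec N c2 s t s' \<Longrightarrow> exec N (Cond b c1 c2) s (1 + bcost b + t) s'"
| WhileFalse: "\<not> bval N b s \<Longrightarrow> exec N (While b c) s (1 + bcost b) s"
| WhileTrue: "bval N b s \<Longrightarrow> exec N c s t1 s' \<Longrightarrow> exec N (While b c) s' t2 s'' \<Longrightarrow>
    exec N (While b c) s (1 + bcost b + t1 + t2) s''"

lemma exec_deterministic:
  "exec N c s t s' \<Longrightarrow> exec N c s u s'' \<Longrightarrow> t = u \<and> s' = s''"
proof (induction arbitrary: u s'' rule: exec.induct)
  case (Seq c1 s t1 s' c2 t2 s2)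
  from Seq.prems show ?case
    by (cases rule: exec.cases) (use Seq.IH in blast)
next
  case (CondTrue b s c1 t s' c2)
  from CondTrue.prems show ?case
    by (cases rule: exec.cases) (use CondTrue.IH CondTrue.hyps in blast)+
next
  case (CondFalse b s c2 t s' c1)
  from CondFalse.prems show ?case
    by (cases rule: exec.cases) (use CondFalse.IH CondFalse.hyps in blast)+
next
  case (WhileFalse b s c)
  from WhileFalse.prems show ?case
    by (cases rule: exec.cases) (use WhileFalse.hyps in blast)+
next
  case (WhileTrue b s c t1 s' t2 s2)
  from WhileTrue.prems show ?case
    by (cases rule: exec.cases) (use WhileTrue.IH WhileTrue.hyps in blast)+
qed (erule exec.cases; simp)+


section \<open>The 2-center problem with constrained circles\<close>

definition two_center_solution ::
  "(point \<Rightarrow> real) \<Rightarrow> point set \<Rightarrow> real \<Rightarrow> point \<Rightarrow> point \<Rightarrow> bool" where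
  "two_center_solution N K r p q \<longleftrightarrow> p \<in> K \<and> q \<in> K \<and> K \<subseteq> disc N p r \<union> disc N q 1"

text \<open>The input points are given as a list, in arbitrary order; all memory not used by the input is
  zero.\<close>

definition two_center_input :: "point list \<Rightarrow> real \<Rightarrow> state" where
  "two_center_input xs r = \<lparr>
     iv = (\<lambda>_. 0)(''n'' := length xs),
     rv = (\<lambda>_. 0)(''r'' := r),
     ia = (\<lambda>_ _. 0),
     ra = (\<lambda>_ _. 0)
       (''x'' := \<lambda>i. if i < length xs then fst (xs ! i) else 0,
        ''y'' := \<lambda>i. if i < length xs then snd (xs ! i) else 0)\<rparr>"

definition two_center_output :: "(point \<Rightarrow> real) \<Rightarrow> point set \<Rightarrow> real \<Rightarrow> state \<Rightarrow> bool" where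
  "two_center_output N K r s \<longleftrightarrow>
     (if \<exists>p q. two_center_solution N K r p q
      then iv s ''found'' = 1 \<and>
        two_center_solution N K r (rv s ''px'', rv s ''py'') (rv s ''qx'', rv s ''qy'')
      else iv s ''found'' = 0)"

text \<open>\<open>T\<close> bounds the running time on all sets of \<open>n\<close> points, all radii and all orders in which the
  points are listed.\<close>

definition solves_two_center_within :: "(point \<Rightarrow> real) \<Rightarrow> com \<Rightarrow> (nat \<Rightarrow> nat) \<Rightarrow> bool" where
  "solves_two_center_within N prog T \<longleftrightarrow>
     (\<forall>K r xs. finite K \<and> r \<ge> 1 \<and> distinct xs \<and> set xs = K \<longrightarrow>
        (\<exists>t s. exec N prog (two_center_input xs r) t s \<and> t \<le> T (card K)
           \<and> two_center_output N K r s))"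

end

theory Submission
  imports Defs
begin

text \<open>Fix the centre \<open>p\<close> of the large disc and call an input point far if it lies outside that disc. A
point \<open>q\<close> completes \<open>p\<close> to a solution if and only if \<open>q\<close> lies in the unit discs around
all far points. It is enough to find all such \<open>q\<close> in linear time for each \<open>p\<close>, once the points
have been sorted by abscissa; the sorting itself may cost quadratic time.

Let \<open>tip\<close> be the rightmost point of the unit circle. The unit disc around \<open>z\<close> consists of the
points whose abscissa differs from that of \<open>z\<close> by at most \<open>fst tip\<close> and which lie between two
graphs, the upper boundary and the lower boundary. The upper boundaries are translates of one concave
function \<open>height\<close>. For \<open>a\<close> to the left of \<open>b\<close> the difference of the two upper boundaries is
therefore antitone (\<open>boundary_difference_antimono\<close>): to the right of some threshold the boundary of
\<open>a\<close> is the lower one, to the left of it the boundary of \<open>b\<close>. Curves with this property have a lower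
envelope that can be built like the lower envelope of lines: scan the far points from left to right, keep
the relevant ones on a stack, and pop the top if the new threshold makes it superfluous. Queries with
ascending abscissas then pop the top as soon as they reach its threshold, and the remaining top is the lowest
boundary at the current query. Each point is pushed once and popped at most once, so a pass is linear.

The threshold of two centres is the abscissa of an intersection point of the two unit circles that lies on
both upper arcs. By strict convexity two different circles have at most two common points
(\<open>card_circle_inter\<close>), so they can be inspected in constant time. If there is no such point, one
boundary lies below the other on the whole common domain, and the chord from \<open>- tip\<close> to \<open>tip\<close>
tells which one (\<open>default_separates\<close>).

Evaluating an upper boundary at a given abscissa is not an operation of the machine. A query
\<open>q\<close> is therefore answered by distances alone: \<open>q\<close> has to be within distance 1 of the leftmost and
the rightmost far point, which puts its abscissa into the domain of all boundaries, and within distance 1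
of the centre on top of the stack, which puts it below the lowest boundary (\<open>pending_verdict\<close>). Conversely,
a point that lies in the unit discs around all far points passes these tests.

Lower boundaries are upper boundaries of the points reflected in the origin. The program keeps the reflected
points, in reversed order, behind the original ones and runs the same pass on both halves. A point that
passes both times lies between both boundaries of every unit disc in question, hence in the disc
(\<open>between_boundaries\<close>, \<open>verdicts_agree\<close>).

Each loop has a body without loops or with a known bound, and a measure bounds its iterations. The costs of
the loop bodies enter the bound as the constants \<open>max_cost\<close>.\<close>

section \<open>Geometry of unit circles\<close>

lemma cross2_zero_parallel:
  assumes "cross2 d v = 0" "d \<noteq> 0"
  shows "\<exists>s. v = s *\<^sub>R d"
proof -
  obtain a b p q where [simp]: "d = (a, b)" "v = (p, q)" by (cases d; cases v)
  have e: "a * q = b * p" using assms by simp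
  show ?thesis
  proof (cases "a = 0")
    case True
    then show ?thesis using e assms by (intro exI[of _ "q / b"]) (auto simp: zero_prod_def)
  next
    case False
    then show ?thesis using e by (intro exI[of _ "p / a"]) (auto simp: field_simps)
  qed
qed

context normed_plane begin

lemma N_minus: "N (- x) = N x"
  using scale[of "-1" x] by simp

lemma N_zero: "N 0 = 0"
  by (simp add: zero_iff)

lemma N_nonneg: "0 \<le> N x"
  using triangle[of x "- x"] by (simp add: N_minus N_zero)

lemma N_convex:
  assumes "0 \<le> l" "l \<le> 1"
  shows "N ((1 - l) *\<^sub>R a + l *\<^sub>R b) \<le> (1 - l) * N a + l * N b"
  using triangle[of "(1 - l) *\<^sub>R a" "l *\<^sub>R b"] assms by (simp add: scale)

lemma N_le_norm: "N x \<le> (N (1, 0) + N (0, 1)) * norm x"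
proof -
  have "N x = N (fst x *\<^sub>R (1, 0) + snd x *\<^sub>R (0, 1))"
    by simp
  also have "\<dots> \<le> \<bar>fst x\<bar> * N (1, 0) + \<bar>snd x\<bar> * N (0, 1)"
    using triangle[of "fst x *\<^sub>R (1, 0)" "snd x *\<^sub>R (0, 1)"] unfolding scale .
  also have "\<dots> \<le> norm x * N (1, 0) + norm x * N (0, 1)"
    using norm_fst_le[of "fst x" "snd x"] norm_snd_le[of "snd x" "fst x"]
    by (intro add_mono mult_right_mono N_nonneg) auto
  finally show ?thesis by (simp add: algebra_simps)
qed

lemma continuous_N: "continuous_on S N"
proof -
  define M where "M = N (1, 0) + N (0, 1)"
  have "\<bar>N x - N y\<bar> \<le> M * norm (x - y)" for x y
  proof -
    have "N x \<le> N y + N (x - y)" "N y \<le> N x + N (y - x)"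
      using triangle[of y "x - y"] triangle[of x "y - x"] by auto
    moreover have "N (x - y) \<le> M * norm (x - y)" "N (y - x) \<le> M * norm (x - y)"
      using N_le_norm[of "x - y"] N_le_norm[of "y - x"] by (auto simp: M_def norm_minus_commute)
    ultimately show ?thesis by linarith
  qed
  then have "M-lipschitz_on S N"
    by (intro lipschitz_onI) (auto simp: dist_norm M_def N_nonneg)
  then show ?thesis by (rule lipschitz_on_continuous_on)
qed

lemma compact_unit_disc: "compact {u. N u \<le> 1}"
proof -
  obtain x0 where x0: "x0 \<in> sphere 0 1" "\<And>y. y \<in> sphere (0::point) 1 \<Longrightarrow> N x0 \<le> N y"
    using continuous_attains_inf[OF compact_sphere _ continuous_N, of "0::point" 1] by (auto; force)
  have pos: "N x0 > 0"
    using x0(1) zero_iff[of x0] N_nonneg[of x0] by (cases "x0 = 0") auto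
  have "norm u \<le> 1 / N x0" if "N u \<le> 1" for u
  proof (cases "u = 0")
    case False
    have "N x0 \<le> N (inverse (norm u) *\<^sub>R u)"
      by (rule x0) (use False in auto)
    also have "\<dots> = N u / norm u" by (simp add: scale divide_inverse)
    finally have "N x0 * norm u \<le> 1" using False that by (simp add: field_simps)
    then show ?thesis using pos by (simp add: field_simps)
  qed (use pos in auto)
  then have "bounded {u. N u \<le> 1}" by (auto simp: bounded_iff)
  moreover have "closed {u. N u \<le> 1}"
    by (intro closed_Collect_le continuous_N continuous_on_const)
  ultimately show ?thesis using compact_eq_bounded_closed by blast
qed

end

context strictly_convex_plane begin

text \<open>The hypothesis on the norm only forbids segments on the unit circle. If some interior point of a chord had
norm 1, convexity of the norm would propagate the value 1 to the whole chord.\<close>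

lemma strict_inside:
  assumes "N a \<le> 1" "N b \<le> 1" "a \<noteq> b" "0 < l" "l < 1"
  shows "N ((1 - l) *\<^sub>R a + l *\<^sub>R b) < 1"
proof (rule ccontr)
  define c where "c = (1 - l) *\<^sub>R a + l *\<^sub>R b"
  assume "\<not> N ((1 - l) *\<^sub>R a + l *\<^sub>R b) < 1"
  then have c1: "N c \<ge> 1" by (simp add: c_def)
  \<comment> \<open>\<open>c\<close> lies between \<open>d\<close> and one of the endpoints, whose norms are at most 1.\<close>
  have between: "N d \<ge> 1" if "d = (1 - m) *\<^sub>R a + m *\<^sub>R b" "0 \<le> m" "m \<le> 1" for m d
  proof (cases "m \<le> l")
    case True
    define q where "q = (l - m) / (1 - m)"
    have m1: "m < 1" using True assms by simp
    have q: "0 \<le> q" "q < 1" using True m1 assms by (auto simp: q_def field_simps)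
    have e1: "(1 - q) * (1 - m) = 1 - l" using m1 by (simp add: q_def field_simps)
    have e2: "(1 - q) * m + q = l" using e1 by (simp add: algebra_simps)
    have "(1 - q) *\<^sub>R d + q *\<^sub>R b = ((1 - q) * (1 - m)) *\<^sub>R a + ((1 - q) * m + q) *\<^sub>R b"
      by (simp add: that(1) algebra_simps)
    then have "c = (1 - q) *\<^sub>R d + q *\<^sub>R b" by (simp only: e1 e2 c_def)
    then have "1 \<le> (1 - q) * N d + q * N b"
      using N_convex[of q d b] q c1 by simp
    also have "\<dots> \<le> (1 - q) * N d + q" using assms q by (simp add: mult_left_le)
    finally have "(1 - q) * 1 \<le> (1 - q) * N d" by simp
    then show ?thesis using q by (simp only: mult_le_cancel_left_pos)
  next
    case False
    define q where "q = l / m"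
    have q: "0 < q" "q \<le> 1" using False assms by (auto simp: q_def field_simps)
    have e2: "q * m = l" using False assms by (simp add: q_def field_simps)
    have e1: "(1 - q) + q * (1 - m) = 1 - l" using e2 by (simp add: algebra_simps)
    have "(1 - q) *\<^sub>R a + q *\<^sub>R d = ((1 - q) + q * (1 - m)) *\<^sub>R a + (q * m) *\<^sub>R b"
      by (simp add: that(1) algebra_simps)
    then have "c = (1 - q) *\<^sub>R a + q *\<^sub>R d" by (simp only: e1 e2 c_def)
    then have "1 \<le> (1 - q) * N a + q * N d"
      using N_convex[of q a d] q c1 by simp
    also have "\<dots> \<le> (1 - q) + q * N d" using assms q by (simp add: mult_left_le)
    finally have "q * 1 \<le> q * N d" by simp
    then show ?thesis using q by (simp only: mult_le_cancel_left_pos)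
  qed
  have "N d = 1" if d: "d = (1 - m) *\<^sub>R a + m *\<^sub>R b" "0 \<le> m" "m \<le> 1" for m d
  proof -
    have "N d \<le> (1 - m) * N a + m * N b" using N_convex[of m a b] d by simp
    also have "\<dots> \<le> (1 - m) * 1 + m * 1" using assms d by (intro add_mono mult_left_mono) auto
    finally show ?thesis using between[OF d] by simp
  qed
  then have "closed_segment a b \<subseteq> {x. N x = 1}"
    by (auto simp: closed_segment_def)
  then show False using strictly_convex[OF assms(3)] by simp
qed

lemma collinear_inside:
  assumes "d \<noteq> 0" "N (u + x *\<^sub>R d) \<le> 1" "N (u + z *\<^sub>R d) \<le> 1" "x < y" "y < z"
  shows "N (u + y *\<^sub>R d) < 1"
proof -
  define l where "l = (y - x) / (z - x)"
  have l: "0 < l" "l < 1" using assms by (auto simp: l_def field_simps)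
  have "l * (z - x) = y - x" using assms by (simp add: l_def)
  then have y: "(1 - l) * x + l * z = y" by (simp add: algebra_simps)
  have "(1 - l) *\<^sub>R (u + x *\<^sub>R d) + l *\<^sub>R (u + z *\<^sub>R d) = u + ((1 - l) * x + l * z) *\<^sub>R d"
    by (simp add: algebra_simps)
  moreover have "u + x *\<^sub>R d \<noteq> u + z *\<^sub>R d" using assms by simp
  ultimately show ?thesis
    using strict_inside[OF assms(2,3) _ l] y by simp
qed

text \<open>Let three parallel chords of the unit circle be translates of each other. The parallelogram spanned
by the outer two contains, on the line of the middle one, a chord of the same length whose endpoints are in
the interior of the disc; so the middle chord would have to be longer.\<close>

lemma no_three_chords:
  assumes d: "d \<noteq> 0"
    and on: "N a = 1" "N (a - d) = 1" "N b = 1" "N (b - d) = 1" "N c = 1" "N (c - d) = 1"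
    and lt: "cross2 d a < cross2 d b" "cross2 d b < cross2 d c"
  shows False
proof -
  define l where "l = (cross2 d b - cross2 d a) / (cross2 d c - cross2 d a)"
  have l: "0 < l" "l < 1" using lt by (auto simp: l_def field_simps)
  \<comment> \<open>The point of the segment from \<open>a\<close> to \<open>c\<close> on the line of the middle chord.\<close>
  define v where "v = (1 - l) *\<^sub>R a + l *\<^sub>R c"
  have "a \<noteq> c" using lt by auto
  then have v1: "N v < 1" "N (v - d) < 1"
    using strict_inside[of a c l] strict_inside[of "a - d" "c - d" l] on l
    by (simp_all add: v_def algebra_simps)
  have "l * (cross2 d c - cross2 d a) = cross2 d b - cross2 d a" using lt by (simp add: l_def)
  moreover have "cross2 d (v - b) = (1 - l) * cross2 d a + l * cross2 d c - cross2 d b"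
    by (cases a; cases b; cases c; cases d) (simp add: v_def algebra_simps)
  ultimately have "cross2 d (v - b) = 0" by (simp add: algebra_simps)
  then obtain s where "v - b = s *\<^sub>R d" using cross2_zero_parallel d by blast
  then have v: "v = b + s *\<^sub>R d" by (simp add: algebra_simps)
  have vd: "v - d = b + (s - 1) *\<^sub>R d" by (simp add: v algebra_simps)
  have bd: "N (b + (-1) *\<^sub>R d) = 1" "N (b + 0 *\<^sub>R d) = 1" using on by simp_all
  consider "s > 0" | "s = 0" | "s < 0" by linarith
  then show False
  proof cases
    case 1
    then show False using collinear_inside[of d b "-1" s 0] bd v1 v d by simp
  next
    case 3
    then show False using collinear_inside[of d b "s - 1" 0 "-1"] bd v1 vd d by simp
  qed (use v v1 on in auto)
qed

text \<open>A common point \<open>u\<close> of the two circles corresponds to the chord from \<open>u - z2\<close> to \<open>u - z1\<close>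
of the unit circle, a translate of \<open>z2 - z1\<close>. Two such chords never lie on the same line, and of three
on different lines one is between the others.\<close>

lemma card_circle_inter:
  assumes "z1 \<noteq> z2"
  shows "finite (circle N z1 1 \<inter> circle N z2 1) \<and> card (circle N z1 1 \<inter> circle N z2 1) \<le> 2"
proof (rule ccontr)
  define S where "S = circle N z1 1 \<inter> circle N z2 1"
  define d where "d = z2 - z1"
  have d: "d \<noteq> 0" using assms by (simp add: d_def)
  have S: "N (u - z1) = 1" "N (u - z1 - d) = 1" if "u \<in> S" for u
    using that by (auto simp: S_def circle_def d_def)
  \<comment> \<open>The value of \<open>cross2 d\<close> identifies the line of direction \<open>d\<close> through a point.\<close>
  have levels: "cross2 d (u - z1) \<noteq> cross2 d (u' - z1)" if uS: "u \<in> S" "u' \<in> S" "u \<noteq> u'" for u u'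
  proof
    assume "cross2 d (u - z1) = cross2 d (u' - z1)"
    then have "cross2 d (u' - u) = 0"
      by (cases u; cases u'; cases d; cases z1) (simp add: algebra_simps)
    then obtain s where s: "u' - u = s *\<^sub>R d" using cross2_zero_parallel d by blast
    then have u': "u' - z1 = (u - z1) + s *\<^sub>R d" "u' - z1 - d = (u - z1) + (s - 1) *\<^sub>R d"
      by (auto simp: algebra_simps)
    have ud: "N ((u - z1) + (-1) *\<^sub>R d) = 1" "N ((u - z1) + 0 *\<^sub>R d) = 1" using S[OF uS(1)] by simp_all
    have "s \<noteq> 0" using s that by auto
    then consider "s > 0" | "s < 0" by linarith
    then show False
    proof cases
      case 1
      then show False using collinear_inside[of d "u - z1" "-1" s 0] ud S[OF uS(2)] d u' by simp
    next
      case 2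
      moreover have "N ((u - z1) + (s - 1) *\<^sub>R d) = 1"
        using S(2)[OF uS(2)] unfolding u'(2) .
      ultimately show False using collinear_inside[of d "u - z1" "s - 1" 0 "-1"] ud d by simp
    qed
  qed
  have no3: False if "u \<in> S" "v \<in> S" "w \<in> S" "cross2 d (u - z1) < cross2 d (v - z1)"
      "cross2 d (v - z1) < cross2 d (w - z1)" for u v w
    using no_three_chords[OF d] S that by blast
  assume "\<not> (finite (circle N z1 1 \<inter> circle N z2 1) \<and> card (circle N z1 1 \<inter> circle N z2 1) \<le> 2)"
  then have "infinite S \<or> 3 \<le> card S" unfolding S_def by auto
  then obtain T where "T \<subseteq> S" "card T = 3"
    using infinite_arbitrarily_large obtain_subset_with_card_n by metis
  then obtain u v w where uvw: "u \<in> S" "v \<in> S" "w \<in> S" "u \<noteq> v" "v \<noteq> w" "u \<noteq> w"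
    by (auto simp: card_3_iff)
  define f where "f u = cross2 d (u - z1)" for u
  have "f u \<noteq> f v" "f v \<noteq> f w" "f u \<noteq> f w"
    using levels uvw unfolding f_def by blast+
  then consider "f u < f v" "f v < f w" | "f u < f w" "f w < f v" | "f v < f u" "f u < f w"
    | "f v < f w" "f w < f u" | "f w < f u" "f u < f v" | "f w < f v" "f v < f u"
    by linarith
  then show False
    by cases (use no3 uvw in \<open>unfold f_def, blast\<close>)+
qed

text \<open>The rightmost point of the unit circle. Its abscissa is half the width of the disc, and
\<open>- tip\<close> is the leftmost point.\<close>

definition tip :: point where
  "tip = (SOME v. N v \<le> 1 \<and> (\<forall>u. N u \<le> 1 \<longrightarrow> fst u \<le> fst v))"

lemma tip_props: "N tip \<le> 1 \<and> (\<forall>u. N u \<le> 1 \<longrightarrow> fst u \<le> fst tip)"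
proof -
  have "0 \<in> {u. N u \<le> 1}" using N_zero by simp
  then have "{u. N u \<le> 1} \<noteq> {}" by blast
  then have "\<exists>v\<in>{u. N u \<le> 1}. \<forall>u\<in>{u. N u \<le> 1}. fst u \<le> fst v"
    by (intro continuous_attains_sup compact_unit_disc continuous_intros)
  then have "\<exists>v. N v \<le> 1 \<and> (\<forall>u. N u \<le> 1 \<longrightarrow> fst u \<le> fst v)" by simp
  then show ?thesis unfolding tip_def by (rule someI_ex)
qed

lemma fst_le_tip: "N u \<le> 1 \<Longrightarrow> \<bar>fst u\<bar> \<le> fst tip"
  using tip_props N_minus[of u] by (metis abs_le_iff fst_uminus)

lemma fst_tip_pos: "fst tip > 0"
proof -
  have p: "N (1, 0) > 0" using zero_iff[of "(1,0)"] N_nonneg[of "(1,0)"] by (auto simp: less_le zero_prod_def)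
  have "N ((1 / N (1,0)) *\<^sub>R (1, 0)) = 1" unfolding scale using p by simp
  then have "N (1 / N (1,0), 0) \<le> 1" by simp
  from fst_le_tip[OF this] p show ?thesis by (simp add: less_le_trans[of 0 "1 / N (1, 0)"])
qed

text \<open>With a second rightmost point, the midpoint of the two would have norm less than 1, and scaling it to
norm 1 would move it further to the right.\<close>

lemma tip_unique:
  assumes "N u \<le> 1" "fst u = fst tip"
  shows "u = tip"
proof (rule ccontr)
  assume ne: "u \<noteq> tip"
  define m where "m = (1 - 1/2) *\<^sub>R u + (1/2) *\<^sub>R tip"
  have m: "N m < 1" unfolding m_def
    using strict_inside[of u tip "1/2"] assms ne tip_props by simp
  have fm: "fst m = fst tip" using assms by (simp add: m_def)
  have pos: "N m > 0" using zero_iff[of m] N_nonneg[of m] fm fst_tip_pos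
    by (metis fst_zero less_le)
  have "N ((1 / N m) *\<^sub>R m) = 1" unfolding scale using pos by simp
  then have "fst ((1 / N m) *\<^sub>R m) \<le> fst tip" using fst_le_tip by (metis abs_le_iff order_refl)
  then have "fst tip / N m \<le> fst tip" using fm by simp
  then have "fst tip \<le> fst tip * N m" using pos by (simp add: field_simps)
  then show False using m fst_tip_pos by simp
qed

lemma N_tip: "N tip = 1"
proof (rule ccontr)
  assume "N tip \<noteq> 1"
  then have lt: "N tip < 1" using tip_props by simp
  have pos: "N tip > 0" using zero_iff[of tip] N_nonneg[of tip] fst_tip_pos
    by (metis fst_zero less_le)
  have "N ((1 / N tip) *\<^sub>R tip) = 1" unfolding scale using pos by simp
  then have "fst ((1 / N tip) *\<^sub>R tip) \<le> fst tip" using fst_le_tip by (metis abs_le_iff order_refl)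
  then have "fst tip / N tip \<le> fst tip" by simp
  then have "fst tip \<le> fst tip * N tip" using pos by (simp add: field_simps)
  then show False using lt fst_tip_pos by simp
qed

lemma touch_points_vertical: "touch_points N 0 1 (0, 1) = {tip, - tip}"
proof -
  have cr: "cross2 (0, 1) v = - fst v" for v :: point by (cases v) simp
  have "z = tip" if "N z = 1" "\<forall>y. N y \<le> 1 \<longrightarrow> fst y \<le> fst z" for z
    using that tip_props by (intro tip_unique antisym) (blast intro: eq_refl)+
  moreover have "z = - tip" if "N z = 1" "\<forall>y. N y \<le> 1 \<longrightarrow> fst z \<le> fst y" for z
  proof -
    have "- z = tip"
    proof (intro tip_unique antisym)
      show "N (- z) \<le> 1" using that by (simp add: N_minus)
      show "fst (- z) \<le> fst tip" using fst_le_tip[of z] that by simp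
      have "fst z \<le> fst (- tip)" using spec[OF that(2), of "- tip"] tip_props N_minus[of tip] by simp
      then show "fst tip \<le> fst (- z)" by simp
    qed
    then show ?thesis by (metis minus_minus)
  qed
  moreover have "fst (- tip) \<le> fst y" if "N y \<le> 1" for y
    using fst_le_tip[OF that] by simp
  moreover have "fst y \<le> fst tip" if "N y \<le> 1" for y
    using fst_le_tip[OF that] by simp
  ultimately show ?thesis
    by (auto simp: touch_points_def circle_def disc_def cr N_tip N_minus)
qed

text \<open>The upper half of the unit circle as the graph of a function on the interval
\<open>{- fst tip..fst tip}\<close>.\<close>

definition height :: "real \<Rightarrow> real" where
  "height t = (SOME y. N (t, y) \<le> 1 \<and> (\<forall>y'. N (t, y') \<le> 1 \<longrightarrow> y' \<le> y))"

text \<open>The chord from \<open>- tip\<close> to \<open>tip\<close> separates the upper from the lower arc; the sign of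
\<open>cross2 tip\<close> tells the two sides apart.\<close>

lemma chord_inside:
  assumes "\<bar>t\<bar> \<le> fst tip"
  shows "N (t, t / fst tip * snd tip) \<le> 1"
proof -
  have "(t, t / fst tip * snd tip) = (t / fst tip) *\<^sub>R tip"
    using fst_tip_pos by (intro prod_eqI) auto
  then have "N (t, t / fst tip * snd tip) = \<bar>t / fst tip\<bar>"
    by (simp only: scale N_tip)
  then show ?thesis using assms fst_tip_pos by simp
qed

lemma height_props:
  assumes "\<bar>t\<bar> \<le> fst tip"
  shows "N (t, height t) \<le> 1" and "N (t, y) \<le> 1 \<Longrightarrow> y \<le> height t"
proof -
  define S where "S = {u. N u \<le> 1} \<inter> {u. fst u = t}"
  have "closed {u::point. fst u = t}" by (intro closed_Collect_eq continuous_intros)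
  then have c: "compact S" unfolding S_def by (intro compact_Int_closed compact_unit_disc)
  have "S \<noteq> {}" using chord_inside[OF assms] by (auto simp: S_def)
  then obtain v where v: "v \<in> S" "\<And>u. u \<in> S \<Longrightarrow> snd u \<le> snd v"
    using continuous_attains_sup[OF c _ continuous_on_snd[OF continuous_on_id]] by auto
  then have "\<exists>y. N (t, y) \<le> 1 \<and> (\<forall>y'. N (t, y') \<le> 1 \<longrightarrow> y' \<le> y)"
    by (intro exI[of _ "snd v"]) (auto simp: S_def)
  from someI_ex[OF this] show "N (t, height t) \<le> 1" "N (t, y) \<le> 1 \<Longrightarrow> y \<le> height t"
    by (auto simp: height_def)
qed

lemma N_height:
  assumes "\<bar>t\<bar> \<le> fst tip"
  shows "N (t, height t) = 1"
proof (rule ccontr)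
  assume "N (t, height t) \<noteq> 1"
  then have lt: "N (t, height t) < 1" using height_props(1)[OF assms] by simp
  have p: "N (0, 1) > 0" using zero_iff[of "(0,1)"] N_nonneg[of "(0,1)"] by (auto simp: less_le zero_prod_def)
  define q where "q = (1 - N (t, height t)) / N (0, 1)"
  have q: "q > 0" "q * N (0, 1) = 1 - N (t, height t)" using lt p by (auto simp: q_def)
  have "N ((t, height t) + q *\<^sub>R (0, 1)) \<le> N (t, height t) + q * N (0, 1)"
    using triangle[of "(t, height t)" "q *\<^sub>R (0, 1)"] q(1) unfolding scale by simp
  then have "N (t, height t + q) \<le> 1" using q by simp
  from height_props(2)[OF assms this] q show False by simp
qed

lemma height_concave:
  assumes "\<bar>a\<bar> \<le> fst tip" "\<bar>b\<bar> \<le> fst tip" "0 \<le> l" "l \<le> 1"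
  shows "(1 - l) * height a + l * height b \<le> height ((1 - l) * a + l * b)"
proof -
  have "N ((1 - l) *\<^sub>R (a, height a) + l *\<^sub>R (b, height b)) \<le> (1 - l) * 1 + l * 1"
    using N_convex[OF assms(3,4), of "(a, height a)" "(b, height b)"] N_height assms by simp
  then have *: "N ((1 - l) * a + l * b, (1 - l) * height a + l * height b) \<le> 1" by simp
  show ?thesis using fst_le_tip[OF *] by (intro height_props(2) *) simp
qed

text \<open>Concavity in the form needed to compare translates: moving two arguments towards each other with their sum
kept fixed does not decrease the sum of the values.\<close>

lemma height_exchange:
  assumes "a + b = c + d" "c \<le> a" "c \<le> b" "\<bar>c\<bar> \<le> fst tip" "\<bar>d\<bar> \<le> fst tip"
  shows "height c + height d \<le> height a + height b"
proof (cases "c = d")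
  case True
  then have "a = c" "b = c" using assms by auto
  then show ?thesis using True by simp
next
  case False
  then have cd: "c < d" using assms by auto
  define l where "l = (a - c) / (d - c)"
  have l: "0 \<le> l" "l \<le> 1" using assms cd by (auto simp: l_def field_simps)
  have "l * (d - c) = a - c" using cd by (simp add: l_def)
  then have a: "(1 - l) * c + l * d = a" and b: "(1 - l) * d + l * c = b"
    using assms(1) by (auto simp: algebra_simps)
  show ?thesis
    using height_concave[OF assms(4,5) l] height_concave[OF assms(5,4) l] unfolding a b
    by (simp add: algebra_simps)
qed

lemma cross2_tip: "cross2 tip (t, y) \<ge> 0 \<longleftrightarrow> t / fst tip * snd tip \<le> y"
  using fst_tip_pos by (cases tip) (auto simp: field_simps)

text \<open>A point of the circle on or above the chord but strictly below the upper boundary would be an inner point of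
a vertical segment that ends on the chord and on the circle. At the two ends of the interval, where the chord
itself reaches the circle, uniqueness of \<open>tip\<close> is used instead.\<close>

lemma upper_iff_height:
  assumes "\<bar>t\<bar> \<le> fst tip"
  shows "N (t, y) = 1 \<and> cross2 tip (t, y) \<ge> 0 \<longleftrightarrow> y = height t"
proof
  assume y: "N (t, y) = 1 \<and> cross2 tip (t, y) \<ge> 0"
  define s where "s = t / fst tip * snd tip"
  have sy: "s \<le> y" using y unfolding cross2_tip s_def by simp
  have yh: "y \<le> height t" using y height_props(2)[OF assms] by simp
  show "y = height t"
  proof (rule ccontr)
    assume "y \<noteq> height t"
    then have lt: "y < height t" using yh by simp
    have eq: "N (t, s) = \<bar>t\<bar> / fst tip"
    proof -
      have "(t, s) = (t / fst tip) *\<^sub>R tip"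
        using fst_tip_pos by (intro prod_eqI) (auto simp: s_def)
      then show ?thesis using fst_tip_pos by (simp only: scale N_tip) simp
    qed
    show False
    proof (cases "s = y")
      case True
      then have t: "\<bar>t\<bar> = fst tip" using eq y fst_tip_pos by simp
      consider "t = fst tip" | "- t = fst tip" using t by linarith
      then show False
      proof cases
        case 1
        then have "(t, y) = tip" "(t, height t) = tip"
          using tip_unique[of "(t, y)"] tip_unique[of "(t, height t)"] y N_height[OF assms] by auto
        then have "(t, y) = (t, height t)" by (simp only:)
        then show False using lt by simp
      next
        case 2
        then have "- (t, y) = tip" "- (t, height t) = tip"
          using tip_unique[of "- (t, y)"] tip_unique[of "- (t, height t)"] y N_height[OF assms]
          by (auto simp only: N_minus fst_uminus fst_conv order_refl)
        then have "- (t, y) = - (t, height t)" by (simp only:)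
        then show False using lt by simp
      qed
    next
      case False
      define l where "l = (y - s) / (height t - s)"
      have l: "0 < l" "l < 1" using False sy lt by (auto simp: l_def field_simps)
      have "l * (height t - s) = y - s" using sy lt by (simp add: l_def)
      then have "(1 - l) * s + l * height t = y" by (simp add: algebra_simps)
      then have "(1 - l) *\<^sub>R (t, s) + l *\<^sub>R (t, height t) = (t, y)"
        by (simp add: algebra_simps)
      moreover have "N (t, s) \<le> 1" using chord_inside[OF assms] by (simp add: s_def)
      ultimately show False
        using strict_inside[of "(t, s)" "(t, height t)" l] l N_height[OF assms] y sy lt by simp
    qed
  qed
next
  assume "y = height t"
  then show "N (t, y) = 1 \<and> cross2 tip (t, y) \<ge> 0"
    using N_height[OF assms] height_props(2)[OF assms chord_inside[OF assms]] cross2_tip by auto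
qed

lemma height_tip: "height (fst tip) = snd tip"
  using upper_iff_height[of "fst tip" "snd tip"] fst_tip_pos N_tip cross2_tip[of "fst tip" "snd tip"] by auto

lemma height_minus_tip: "height (- fst tip) = - snd tip"
  using upper_iff_height[of "- fst tip" "- snd tip"] fst_tip_pos N_tip N_minus[of tip] cross2_tip[of "- fst tip" "- snd tip"]
  by (cases tip) auto

text \<open>Continuity has to hold up to the ends of the interval, where concavity does not provide it. The projection
of the upper arc to the first coordinate is a continuous injection on a compact set, so its inverse is
continuous.\<close>

lemma continuous_height: "continuous_on {- fst tip..fst tip} height"
proof -
  define A where "A = {u. N u = 1} \<inter> {u. cross2 tip u \<ge> 0}"
  have cr: "cross2 tip u = fst tip * snd u - snd tip * fst u" for u
    by (cases tip; cases u) simp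
  have "closed {u. N u = 1}" "closed {u. cross2 tip u \<ge> 0}" unfolding cr
    by (intro closed_Collect_eq closed_Collect_le continuous_N continuous_intros)+
  then have "compact ({u. N u \<le> 1} \<inter> A)"
    unfolding A_def by (intro compact_Int_closed closed_Int compact_unit_disc)
  moreover have "{u. N u \<le> 1} \<inter> A = A" by (auto simp: A_def)
  ultimately have "compact A" by simp
  moreover have "\<forall>u\<in>A. (fst u, height (fst u)) = u"
  proof
    fix u assume "u \<in> A"
    then have "N (fst u, snd u) = 1 \<and> cross2 tip (fst u, snd u) \<ge> 0" by (simp add: A_def)
    then show "(fst u, height (fst u)) = u"
      using upper_iff_height[of "fst u" "snd u"] fst_le_tip[of u] by (simp add: prod_eq_iff)
  qed
  ultimately have "continuous_on (fst ` A) (\<lambda>t. (t, height t))"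
    by (intro continuous_on_inv[where f = fst] continuous_intros) auto
  then have "continuous_on (fst ` A) height"
    using continuous_on_snd by fastforce
  moreover have "{- fst tip..fst tip} \<subseteq> fst ` A"
  proof
    fix t assume "t \<in> {- fst tip..fst tip}"
    then have "(t, height t) \<in> A" using upper_iff_height[of t "height t"] by (auto simp: A_def)
    then show "t \<in> fst ` A" by force
  qed
  ultimately show ?thesis by (rule continuous_on_subset)
qed

text \<open>The upper boundary of the unit disc around \<open>z\<close>.\<close>

definition boundary :: "point \<Rightarrow> real \<Rightarrow> real" where
  "boundary z x = snd z + height (x - fst z)"

lemma below_boundary:
  assumes "N (q - z) \<le> 1"
  shows "snd q \<le> boundary z (fst q)"
  using height_props(2)[of "fst q - fst z" "snd q - snd z"] fst_le_tip[OF assms] assms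
  by (cases q; cases z) (simp add: boundary_def)

text \<open>The lower boundary of a disc is the reflection of the upper boundary of the reflected disc. A point of
the strip between them is on a vertical segment whose endpoints belong to the disc.\<close>

lemma between_boundaries:
  assumes "\<bar>fst q - fst z\<bar> \<le> fst tip"
    and "snd q \<le> boundary z (fst q)" "- snd q \<le> boundary (- z) (- fst q)"
  shows "N (q - z) \<le> 1"
proof -
  define t y where "t = fst q - fst z" and "y = snd q - snd z"
  have t: "\<bar>t\<bar> \<le> fst tip" "\<bar>- t\<bar> \<le> fst tip" using assms by (auto simp: t_def)
  have y: "y \<le> height t" "- height (- t) \<le> y" using assms by (auto simp: boundary_def t_def y_def)
  have on: "N (t, height t) = 1" "N (t, - height (- t)) = 1"
    using N_height[OF t(1)] N_height[OF t(2)] N_minus[of "(t, - height (- t))"] by auto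
  have "N (t, y) \<le> 1"
  proof (cases "- height (- t) = height t")
    case True
    then have "y = height t" using y by simp
    then show ?thesis using on by simp
  next
    case False
    define l where "l = (y + height (- t)) / (height t + height (- t))"
    have pos: "height t + height (- t) > 0" using False y by linarith
    have l: "0 \<le> l" "l \<le> 1" using y pos by (auto simp: l_def field_simps)
    have "l * (height t + height (- t)) = y + height (- t)" using pos by (simp add: l_def)
    then have "(1 - l) * (- height (- t)) + l * height t = y" by (simp add: algebra_simps)
    then have "(1 - l) *\<^sub>R (t, - height (- t)) + l *\<^sub>R (t, height t) = (t, y)"
      by (simp add: algebra_simps)
    then show ?thesis using N_convex[OF l, of "(t, - height (- t))" "(t, height t)"] on by simp
  qed
  then show ?thesis by (simp add: t_def y_def minus_prod_def)
qed

lemma boundary_difference_antimono: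
  assumes "fst a \<le> fst b" "fst b - fst tip \<le> x" "x \<le> x'" "x' \<le> fst a + fst tip"
  shows "boundary a x' - boundary b x' \<le> boundary a x - boundary b x"
proof -
  have "\<bar>x - fst b\<bar> \<le> fst tip" "\<bar>x' - fst a\<bar> \<le> fst tip" using assms by linarith+
  then show ?thesis
    using height_exchange[of "x - fst a" "x' - fst b" "x - fst b" "x' - fst a"] assms
    by (simp add: boundary_def)
qed

text \<open>The range of \<open>x\<close> is the common domain of the two boundaries when \<open>a\<close> is not to the right of
\<open>b\<close>.\<close>

definition separates :: "point \<Rightarrow> point \<Rightarrow> real \<Rightarrow> bool" where
  "separates a b t \<longleftrightarrow> (\<forall>x. fst b - fst tip \<le> x \<and> x \<le> fst a + fst tip \<longrightarrow>
     (t \<le> x \<longrightarrow> boundary a x \<le> boundary b x) \<and> (x < t \<longrightarrow> boundary b x \<le> boundary a x))"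

definition upper_common :: "point \<Rightarrow> point \<Rightarrow> point \<Rightarrow> bool" where
  "upper_common a b u \<longleftrightarrow> cross2 tip (u - a) \<ge> 0 \<and> cross2 tip (u - b) \<ge> 0"

lemma on_upper_arc:
  assumes "N (u - a) = 1" "cross2 tip (u - a) \<ge> 0"
  shows "boundary a (fst u) = snd u"
proof -
  have "snd (u - a) = height (fst (u - a))"
    using upper_iff_height[of "fst (u - a)" "snd (u - a)"] fst_le_tip[of "u - a"] assms
    unfolding prod.collapse by (simp del: fst_diff snd_diff)
  then show ?thesis by (simp add: boundary_def)
qed

lemma upper_arc_point:
  assumes "\<bar>x - fst a\<bar> \<le> fst tip"
  shows "N ((x, boundary a x) - a) = 1" "cross2 tip ((x, boundary a x) - a) \<ge> 0"
proof -
  have "(x, boundary a x) - a = (x - fst a, height (x - fst a))"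
    by (intro prod_eqI) (simp_all add: boundary_def)
  then show "N ((x, boundary a x) - a) = 1" "cross2 tip ((x, boundary a x) - a) \<ge> 0"
    using upper_iff_height[OF assms, of "height (x - fst a)"] by simp_all
qed

text \<open>At a common point of both upper arcs the antitone difference of the boundaries vanishes.\<close>

lemma crossing_separates:
  assumes "fst a \<le> fst b" "u \<in> circle N a 1 \<inter> circle N b 1" "upper_common a b u"
  shows "separates a b (fst u)"
proof -
  have u: "boundary a (fst u) = snd u" "boundary b (fst u) = snd u"
    using on_upper_arc assms by (auto simp: circle_def upper_common_def)
  have "\<bar>fst u - fst a\<bar> \<le> fst tip" "\<bar>fst u - fst b\<bar> \<le> fst tip"
    using fst_le_tip[of "u - a"] fst_le_tip[of "u - b"] assms by (auto simp: circle_def)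
  then show ?thesis
    using boundary_difference_antimono[OF assms(1), of "fst u"]
      boundary_difference_antimono[OF assms(1), of _ "fst u"] u
    unfolding separates_def by fastforce
qed

lemma crossing_exists:
  assumes "boundary b x \<le> boundary a x" "boundary a x' \<le> boundary b x'"
    and "fst b - fst tip \<le> x" "x \<le> x'" "x' \<le> fst a + fst tip" "fst a \<le> fst b"
  shows "\<exists>u \<in> circle N a 1 \<inter> circle N b 1. upper_common a b u"
proof -
  have "continuous_on {x..x'} (\<lambda>y. boundary c y)" if "c = a \<or> c = b" for c
    unfolding boundary_def
    by (intro continuous_intros continuous_on_compose2[OF continuous_height]) (use that assms in auto)
  then have "continuous_on {x..x'} (\<lambda>y. boundary b y - boundary a y)"
    by (intro continuous_on_diff) auto
  then obtain y where y: "x \<le> y" "y \<le> x'" "boundary b y = boundary a y"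
    using IVT'[of "\<lambda>y. boundary b y - boundary a y" x 0 x'] assms by auto
  have "\<bar>y - fst a\<bar> \<le> fst tip" "\<bar>y - fst b\<bar> \<le> fst tip" using y assms by auto
  from upper_arc_point[OF this(1)] upper_arc_point[OF this(2)] y(3) show ?thesis
    by (intro bexI[of _ "(y, boundary a y)"]) (simp_all add: upper_common_def circle_def)
qed

text \<open>The left end of the common domain, or a value to the right of all its points.\<close>

definition default_threshold :: "point \<Rightarrow> point \<Rightarrow> real" where
  "default_threshold a b = (if cross2 tip (b - a) \<ge> 0 then fst b - fst tip else fst a + fst tip + 1)"

text \<open>Without a crossing, the intermediate value theorem makes one boundary the lower one on the whole common
domain, and a single abscissa decides which. If \<open>b\<close> is not below the line through \<open>a\<close> parallel
to \<open>tip\<close>, consider the right end of the domain: the boundary of \<open>a\<close> is on the chord there, that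
of \<open>b\<close> not below the parallel chord through \<open>b\<close>. Otherwise the left end serves in the same way.\<close>

lemma default_separates:
  assumes "fst a \<le> fst b" "\<not> (\<exists>u \<in> circle N a 1 \<inter> circle N b 1. upper_common a b u)"
  shows "separates a b (default_threshold a b)"
proof (cases "cross2 tip (b - a) \<ge> 0")
  case True
  have "boundary a x \<le> boundary b x" if x: "fst b - fst tip \<le> x" "x \<le> fst a + fst tip" for x
  proof (rule ccontr)
    assume "\<not> boundary a x \<le> boundary b x"
    moreover have "boundary a (fst a + fst tip) \<le> boundary b (fst a + fst tip)"
    proof -
      have "(fst a + fst tip - fst b) / fst tip * snd tip \<le> height (fst a + fst tip - fst b)"
        by (intro height_props(2) chord_inside) (use x assms in auto)
      moreover have "snd a + snd tip \<le> snd b + (fst a + fst tip - fst b) / fst tip * snd tip"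
        using True fst_tip_pos by (cases tip; cases a; cases b) (auto simp: field_simps)
      ultimately show ?thesis by (simp add: boundary_def height_tip)
    qed
    ultimately show False using crossing_exists[of b x a "fst a + fst tip"] x assms by auto
  qed
  then show ?thesis using True by (auto simp: separates_def default_threshold_def)
next
  case False
  have "boundary b x \<le> boundary a x" if x: "fst b - fst tip \<le> x" "x \<le> fst a + fst tip" for x
  proof (rule ccontr)
    assume "\<not> boundary b x \<le> boundary a x"
    moreover have "boundary b (fst b - fst tip) \<le> boundary a (fst b - fst tip)"
    proof -
      have "(fst b - fst tip - fst a) / fst tip * snd tip \<le> height (fst b - fst tip - fst a)"
        by (intro height_props(2) chord_inside) (use x assms in auto)
      moreover have "snd b - snd tip \<le> snd a + (fst b - fst tip - fst a) / fst tip * snd tip"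
        using False fst_tip_pos by (cases tip; cases a; cases b) (auto simp: field_simps)
      ultimately show ?thesis by (simp add: boundary_def height_minus_tip)
    qed
    ultimately show False using crossing_exists[of b "fst b - fst tip" a x] x assms by auto
  qed
  then show ?thesis using False by (auto simp: separates_def default_threshold_def)
qed

lemma enum_points_set: "finite S \<Longrightarrow> set (enum_points S) = S \<and> length (enum_points S) = card S"
proof -
  assume f: "finite S"
  then have "\<exists>ps. distinct ps \<and> set ps = S" using finite_distinct_list by blast
  from someI_ex[OF this] f show ?thesis
    by (auto simp: enum_points_def distinct_card[symmetric])
qed

text \<open>The list has at most two elements if the centres differ. For equal centres it is empty, because the
intersection is infinite, and the default value separates the two equal boundaries like any other.\<close>

definition threshold :: "point \<Rightarrow> point \<Rightarrow> real" where
  "threshold a b =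
     (let us = enum_points (circle N a 1 \<inter> circle N b 1) in
      if 2 \<le> length us \<and> upper_common a b (us ! 1) then fst (us ! 1)
      else if 1 \<le> length us \<and> upper_common a b (us ! 0) then fst (us ! 0)
      else default_threshold a b)"

lemma threshold_separates:
  assumes "fst a \<le> fst b"
  shows "separates a b (threshold a b)"
proof (cases "a = b")
  case True
  then show ?thesis
    using assms unfolding separates_def by auto
next
  case False
  define us where "us = enum_points (circle N a 1 \<inter> circle N b 1)"
  have us: "set us = circle N a 1 \<inter> circle N b 1" "length us \<le> 2"
    using enum_points_set card_circle_inter[OF False] by (auto simp: us_def)
  show ?thesis
  proof (cases "\<exists>u \<in> circle N a 1 \<inter> circle N b 1. upper_common a b u")
    case True
    then obtain i where "i < length us" "upper_common a b (us ! i)"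
      unfolding us(1)[symmetric] by (auto simp: in_set_conv_nth)
    then have "\<exists>u \<in> set us. upper_common a b u \<and> threshold a b = fst u"
      using us(2) by (cases "i = 0"; cases "i = 1") (auto simp: threshold_def us_def[symmetric] Let_def)
    then show ?thesis using crossing_separates[OF assms] us(1) by auto
  next
    case f: False
    then have "\<not> (i < length us \<and> upper_common a b (us ! i))" for i
      unfolding us(1)[symmetric] using nth_mem by blast
    from this[of 0] this[of 1] have "threshold a b = default_threshold a b"
      by (auto simp: threshold_def us_def[symmetric] Let_def)
    then show ?thesis using default_separates[OF assms f] by simp
  qed
qed

end

section \<open>Effect and cost of programs\<close>

fun writes :: "com \<Rightarrow> string set" where
  "writes Skip = {}"
| "writes (ISet x e) = {x}"
| "writes (RSet x e) = {x}"
| "writes (IStore x i e) = {x}"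
| "writes (RStore x i e) = {x}"
| "writes (Inter k u v c1 c2 l) = {k, u, v}"
| "writes (Touch k u v c l d) = {k, u, v}"
| "writes (Seq c1 c2) = writes c1 \<union> writes c2"
| "writes (Cond b c1 c2) = writes c1 \<union> writes c2"
| "writes (While b c) = writes c"

text \<open>One set of names serves all four components of the state. This loses nothing, since the program below never
uses a name for data of two kinds.\<close>

lemma exec_frame:
  assumes "exec N c s t s'" "x \<notin> writes c"
  shows "iv s' x = iv s x" "rv s' x = rv s x" "ia s' x = ia s x" "ra s' x = ra s x"
proof -
  from assms have "iv s' x = iv s x \<and> rv s' x = rv s x \<and> ia s' x = ia s x \<and> ra s' x = ra s x"
    by (induction rule: exec.induct) (auto simp: store_points_def)
  then show "iv s' x = iv s x" "rv s' x = rv s x" "ia s' x = ia s x" "ra s' x = ra s x"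
    by auto
qed

fun loop_free :: "com \<Rightarrow> bool" where
  "loop_free (Seq c1 c2) = (loop_free c1 \<and> loop_free c2)"
| "loop_free (Cond b c1 c2) = (loop_free c1 \<and> loop_free c2)"
| "loop_free (While b c) = False"
| "loop_free c = True"

text \<open>Final state and worst-case cost of programs without loops; the values for loops are dummies.\<close>

fun eff :: "(point \<Rightarrow> real) \<Rightarrow> com \<Rightarrow> state \<Rightarrow> state" where
  "eff N Skip s = s"
| "eff N (ISet x e) s = s\<lparr>iv := (iv s)(x := ival e s)\<rparr>"
| "eff N (RSet x e) s = s\<lparr>rv := (rv s)(x := rval N e s)\<rparr>"
| "eff N (IStore x i e) s = s\<lparr>ia := (ia s)(x := (ia s x)(ival i s := ival e s))\<rparr>"
| "eff N (RStore x i e) s = s\<lparr>ra := (ra s)(x := (ra s x)(ival i s := rval N e s))\<rparr>"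
| "eff N (Inter k u v c1 c2 l) s = store_points k u v
      (enum_points (circle N (pval N c1 s) (rval N l s) \<inter> circle N (pval N c2 s) (rval N l s))) s"
| "eff N (Touch k u v c l d) s = store_points k u v
      (enum_points (touch_points N (pval N c s) (rval N l s) (of_int (fst d), of_int (snd d)))) s"
| "eff N (Seq c1 c2) s = eff N c2 (eff N c1 s)"
| "eff N (Cond b c1 c2) s = (if bval N b s then eff N c1 s else eff N c2 s)"
| "eff N (While b c) s = s"

fun max_cost :: "com \<Rightarrow> nat" where
  "max_cost Skip = 1"
| "max_cost (ISet x e) = 1 + icost e"
| "max_cost (RSet x e) = 1 + rcost e"
| "max_cost (IStore x i e) = 1 + icost i + icost e"
| "max_cost (RStore x i e) = 1 + icost i + rcost e"
| "max_cost (Inter k u v c1 c2 l) = 1 + pcost c1 + pcost c2 + rcost l"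
| "max_cost (Touch k u v c l d) = 1 + pcost c + rcost l"
| "max_cost (Seq c1 c2) = 1 + max_cost c1 + max_cost c2"
| "max_cost (Cond b c1 c2) = 1 + bcost b + max (max_cost c1) (max_cost c2)"
| "max_cost (While b c) = 0"

lemma exec_loop_free: "loop_free c \<Longrightarrow> \<exists>t \<le> max_cost c. exec N c s t (eff N c s)"
proof (induction c arbitrary: s)
  case (Touch k u v c l d)
  show ?case
    using exec.Touch[of N k u v c l "fst d" "snd d" s]
    by (intro exI[of _ "max_cost (Touch k u v c l d)"]) simp
next
  case (Seq c1 c2)
  then obtain t1 t2 where "t1 \<le> max_cost c1" "exec N c1 s t1 (eff N c1 s)"
    "t2 \<le> max_cost c2" "exec N c2 (eff N c1 s) t2 (eff N c2 (eff N c1 s))"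
    by (metis loop_free.simps(1))
  then show ?case by (intro exI[of _ "1 + t1 + t2"]) (auto intro: exec.Seq[simplified])
next
  case (Cond b c1 c2)
  then obtain t1 t2 where "t1 \<le> max_cost c1" "exec N c1 s t1 (eff N c1 s)"
    "t2 \<le> max_cost c2" "exec N c2 s t2 (eff N c2 s)"
    by (metis loop_free.simps(2))
  then show ?case
    by (intro exI[of _ "1 + bcost b + (if bval N b s then t1 else t2)"])
       (auto intro: exec.CondTrue[simplified] exec.CondFalse[simplified])
qed ((rule exI, rule conjI, rule order_refl, simp only: max_cost.simps eff.simps, rule exec.intros) | simp)+

lemma eff_frame:
  assumes "loop_free c" "x \<notin> writes c"
  shows "iv (eff N c s) x = iv s x" "rv (eff N c s) x = rv s x"
    "ia (eff N c s) x = ia s x" "ra (eff N c s) x = ra s x"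
  using exec_loop_free[OF assms(1), of N s] exec_frame assms(2) by metis+

text \<open>Total correctness with a bound on the running time.\<close>

definition achieves :: "(point \<Rightarrow> real) \<Rightarrow> com \<Rightarrow> state \<Rightarrow> nat \<Rightarrow> (state \<Rightarrow> bool) \<Rightarrow> bool" where
  "achieves N c s B Q \<longleftrightarrow> (\<exists>t s'. exec N c s t s' \<and> t \<le> B \<and> Q s')"

lemma achieves_loop_free: "loop_free c \<Longrightarrow> Q (eff N c s) \<Longrightarrow> achieves N c s (max_cost c) Q"
  unfolding achieves_def using exec_loop_free[of c N s] by blast

lemma achieves_weaken:
  "achieves N c s B Q \<Longrightarrow> B \<le> B' \<Longrightarrow> (\<And>s'. Q s' \<Longrightarrow> Q' s') \<Longrightarrow> achieves N c s B' Q'"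
  unfolding achieves_def by (meson order_trans)

lemma achieves_frame:
  assumes "achieves N c s B Q"
  shows "achieves N c s B (\<lambda>s'. Q s' \<and> (\<forall>x. x \<notin> writes c \<longrightarrow>
    iv s' x = iv s x \<and> rv s' x = rv s x \<and> ia s' x = ia s x \<and> ra s' x = ra s x))"
  using assms exec_frame unfolding achieves_def by meson

lemma achieves_seq:
  assumes "achieves N c1 s B1 R" "\<And>s'. R s' \<Longrightarrow> achieves N c2 s' B2 Q"
  shows "achieves N (Seq c1 c2) s (1 + B1 + B2) Q"
  using assms unfolding achieves_def
  by (metis exec.Seq add_mono le_refl)

lemma achieves_loop_free_seq:
  assumes "loop_free c1" "achieves N c2 (eff N c1 s) B2 Q"
  shows "achieves N (Seq c1 c2) s (1 + max_cost c1 + B2) Q"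
  using achieves_seq[OF achieves_loop_free[OF assms(1), of "\<lambda>s'. s' = eff N c1 s"]] assms(2) by simp

text \<open>The measure counts iterations only, so that amortized arguments reduce to the choice of a measure.\<close>

lemma achieves_while:
  assumes "I s"
    and step: "\<And>s. I s \<Longrightarrow> bval N b s \<Longrightarrow> achieves N c s B (\<lambda>s'. I s' \<and> \<mu> s' < (\<mu> s :: nat))"
  shows "achieves N (While b c) s ((1 + bcost b + B) * (\<mu> s + 1)) (\<lambda>s'. I s' \<and> \<not> bval N b s')"
  using assms(1)
proof (induction "\<mu> s" arbitrary: s rule: less_induct)
  case less
  show ?case
  proof (cases "bval N b s")
    case False
    then have "exec N (While b c) s (1 + bcost b) s" by (rule exec.WhileFalse)
    then show ?thesis using False less.prems unfolding achieves_def by fastforce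
  next
    case True
    obtain t1 s1 where 1: "exec N c s t1 s1" "t1 \<le> B" "I s1" "\<mu> s1 < \<mu> s"
      using step[OF less.prems True] unfolding achieves_def by blast
    obtain t2 s2 where 2: "exec N (While b c) s1 t2 s2"
        "t2 \<le> (1 + bcost b + B) * (\<mu> s1 + 1)" "I s2 \<and> \<not> bval N b s2"
      using less.hyps[OF 1(4,3)] unfolding achieves_def by blast
    have "(1 + bcost b + B) * (\<mu> s1 + 1) \<le> (1 + bcost b + B) * \<mu> s"
      using 1(4) by (intro mult_le_mono2) simp
    then have "1 + bcost b + t1 + t2 \<le> (1 + bcost b + B) * (\<mu> s + 1)"
      using 1(2) 2(2) by simp
    then show ?thesis
      using exec.WhileTrue[OF True 1(1) 2(1)] 2(3) unfolding achieves_def by blast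
  qed
qed

section \<open>The program\<close>

text \<open>The points are \<open>(x, y)\<close>, the current centre is \<open>(c, d)\<close>, the point under consideration is
\<open>(u, v)\<close>, the far points met first and last are \<open>(f, g)\<close> and \<open>(a, b)\<close>, and \<open>(w, e)\<close>
is \<open>tip\<close>. The stack has height \<open>k\<close>, its centres are \<open>(sx, sy)\<close>, and \<open>st\<close> holds for
each of them, apart from the bottom, the threshold that separates it from the element below it. A pass
works on the block of \<open>n\<close> points that starts at index \<open>o\<close>; it records in \<open>bad\<close> which of
them fail.\<close>

abbreviation "pred e \<equiv> ISub e (ICon 1)"
abbreviation "succ x \<equiv> ISet x (IAdd (IVar x) (ICon 1))"
abbreviation "below x y \<equiv> ILe (IAdd (IVar x) (ICon 1)) (IVar y)"

primrec seqs :: "com list \<Rightarrow> com" where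
  "seqs [] = Skip"
| "seqs (c # cs) = (if cs = [] then c else Seq c (seqs cs))"

text \<open>Insertion sort by abscissa, with the two nested loops flattened into one: element \<open>j\<close> sinks until it
is in place, then the next element \<open>i\<close> takes its turn.\<close>

definition sort_step :: com where
  "sort_step =
     Cond (BAnd (ILe (ICon 1) (IVar ''j''))
                (BNot (RLe (RArr ''x'' (pred (IVar ''j''))) (RArr ''x'' (IVar ''j'')))))
       (seqs [
         RSet ''u'' (RArr ''x'' (pred (IVar ''j''))),
         RSet ''v'' (RArr ''y'' (pred (IVar ''j''))),
         RStore ''x'' (pred (IVar ''j'')) (RArr ''x'' (IVar ''j'')),
         RStore ''y'' (pred (IVar ''j'')) (RArr ''y'' (IVar ''j'')),
         RStore ''x'' (IVar ''j'') (RVar ''u''),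
         RStore ''y'' (IVar ''j'') (RVar ''v''),
         ISet ''j'' (pred (IVar ''j''))])
       (Seq (succ ''i'') (ISet ''j'' (IVar ''i'')))"

definition reflect_step :: com where
  "reflect_step = seqs [
     RStore ''x'' (IAdd (IVar ''n'') (IVar ''i''))
       (RSub (RCon 0) (RArr ''x'' (ISub (pred (IVar ''n'')) (IVar ''i'')))),
     RStore ''y'' (IAdd (IVar ''n'') (IVar ''i''))
       (RSub (RCon 0) (RArr ''y'' (ISub (pred (IVar ''n'')) (IVar ''i'')))),
     succ ''i'']"

text \<open>The two points of contact with vertical lines arrive in unspecified order and are negatives of each other,
so the sign of the first coordinate shows which one was found.\<close>

definition find_tip :: com where
  "find_tip = seqs [
     Touch ''m'' ''ix'' ''iy'' (RCon 0, RCon 0) (RCon 1) (0, 1),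
     RSet ''w'' (RArr ''ix'' (ICon 0)),
     RSet ''e'' (RArr ''iy'' (ICon 0)),
     Cond (RLe (RVar ''w'') (RCon 0))
       (Seq (RSet ''w'' (RSub (RCon 0) (RVar ''w''))) (RSet ''e'' (RSub (RCon 0) (RVar ''e''))))
       Skip]"

text \<open>Evaluates to \<open>cross2 tip (p - q) \<ge> 0\<close>.\<close>

fun above_chord :: "pexp \<Rightarrow> pexp \<Rightarrow> bexp" where
  "above_chord (px, py) (qx, qy) =
     RLe (RMul (RVar ''e'') (RSub px qx)) (RMul (RVar ''w'') (RSub py qy))"

definition stack_top :: pexp where
  "stack_top = (RArr ''sx'' (pred (IVar ''k'')), RArr ''sy'' (pred (IVar ''k'')))"

abbreviation "current \<equiv> (RVar ''u'', RVar ''v'')"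

definition common_upper :: "nat \<Rightarrow> bexp" where
  "common_upper h = BAnd (ILe (ICon (Suc h)) (IVar ''m''))
     (BAnd (above_chord (RArr ''ix'' (ICon h), RArr ''iy'' (ICon h)) stack_top)
           (above_chord (RArr ''ix'' (ICon h), RArr ''iy'' (ICon h)) current))"

definition find_threshold :: com where
  "find_threshold = Seq (Inter ''m'' ''ix'' ''iy'' stack_top current (RCon 1))
     (Cond (common_upper 1) (RSet ''t'' (RArr ''ix'' (ICon 1)))
     (Cond (common_upper 0) (RSet ''t'' (RArr ''ix'' (ICon 0)))
     (Cond (above_chord current stack_top)
       (RSet ''t'' (RSub (RVar ''u'') (RVar ''w'')))
       (RSet ''t'' (RAdd (RAdd (fst stack_top) (RVar ''w'')) (RCon 1))))))"

definition push :: com where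
  "push = seqs [
     RStore ''sx'' (IVar ''k'') (RVar ''u''),
     RStore ''sy'' (IVar ''k'') (RVar ''v''),
     RStore ''st'' (IVar ''k'') (RVar ''t''),
     Cond (ILe (IVar ''k'') (ICon 0)) (Seq (RSet ''f'' (RVar ''u'')) (RSet ''g'' (RVar ''v''))) Skip,
     RSet ''a'' (RVar ''u''),
     RSet ''b'' (RVar ''v''),
     succ ''k'',
     succ ''i'']"

definition load :: "string \<Rightarrow> com" where
  "load h = Seq (RSet ''u'' (RArr ''x'' (IAdd (IVar ''o'') (IVar h))))
                (RSet ''v'' (RArr ''y'' (IAdd (IVar ''o'') (IVar h))))"

fun distance_le :: "pexp \<Rightarrow> pexp \<Rightarrow> rexp \<Rightarrow> bexp" where
  "distance_le (px, py) (qx, qy) l = RLe (RNorm (RSub px qx) (RSub py qy)) l"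

definition stack_guard :: "rexp \<Rightarrow> bexp" where
  "stack_guard e = BAnd (ILe (ICon 2) (IVar ''k'')) (RLe (RArr ''st'' (pred (IVar ''k''))) e)"

abbreviation "pop \<equiv> ISet ''k'' (pred (IVar ''k''))"

text \<open>One iteration skips a point, pops the stack or pushes a point. With an empty stack the computed threshold is
meaningless; it is stored at the bottom of the stack, where it is never used.\<close>

definition build_step :: com where
  "build_step = Seq (load ''i'')
     (Cond (distance_le current (RVar ''c'', RVar ''d'') (RVar ''r'')) (succ ''i'')
       (Seq find_threshold (Cond (stack_guard (RVar ''t'')) pop push)))"

text \<open>An empty stack means that no point is far, so that every query succeeds.\<close>

definition query_step :: com where
  "query_step = Seq (load ''j'')
     (Cond (stack_guard (RVar ''u'')) pop
       (Seq
         (Cond (BAnd (ILe (ICon 1) (IVar ''k''))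
             (BNot (BAnd (distance_le current stack_top (RCon 1))
               (BAnd (distance_le current (RVar ''f'', RVar ''g'') (RCon 1))
                     (distance_le current (RVar ''a'', RVar ''b'') (RCon 1))))))
           (IStore ''bad'' (IAdd (IVar ''o'') (IVar ''j'')) (ICon 1))
           (IStore ''bad'' (IAdd (IVar ''o'') (IVar ''j'')) (ICon 0)))
         (succ ''j'')))"

definition pass :: com where
  "pass = seqs [ISet ''i'' (ICon 0), ISet ''k'' (ICon 0), While (below ''i'' ''n'') build_step,
     ISet ''j'' (ICon 0), While (below ''j'' ''n'') query_step]"

text \<open>The point with index \<open>j\<close> is reflected to the one with index \<open>n - 1 - j\<close> of the second half.\<close>

definition scan_step :: com where
  "scan_step = Seq
     (Cond (ILe (IAdd (IArr ''bad'' (IVar ''j''))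
               (IArr ''bad'' (IAdd (IVar ''n'') (ISub (pred (IVar ''n'')) (IVar ''j''))))) (ICon 0))
       (seqs [ISet ''found'' (ICon 1),
          RSet ''px'' (RArr ''x'' (IVar ''l'')), RSet ''py'' (RArr ''y'' (IVar ''l'')),
          RSet ''qx'' (RArr ''x'' (IVar ''j'')), RSet ''qy'' (RArr ''y'' (IVar ''j''))])
       Skip)
     (succ ''j'')"

definition centre_step :: com where
  "centre_step = seqs [
     seqs [RSet ''c'' (RArr ''x'' (IVar ''l'')), RSet ''d'' (RArr ''y'' (IVar ''l'')), ISet ''o'' (ICon 0)],
     pass,
     seqs [RSet ''c'' (RSub (RCon 0) (RVar ''c'')), RSet ''d'' (RSub (RCon 0) (RVar ''d'')),
       ISet ''o'' (IVar ''n'')],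
     pass,
     ISet ''j'' (ICon 0),
     While (below ''j'' ''n'') scan_step,
     succ ''l'']"

definition two_center_program :: com where
  "two_center_program = seqs [
     While (below ''i'' ''n'') sort_step,
     ISet ''i'' (ICon 0),
     While (below ''i'' ''n'') reflect_step,
     find_tip,
     While (below ''l'' ''n'') centre_step]"

section \<open>Stacks of boundaries\<close>

lemma loop_free_find_threshold: "loop_free find_threshold"
  by (simp add: find_threshold_def)

lemma writes_find_threshold: "writes find_threshold = {''m'', ''ix'', ''iy'', ''t''}"
  by (auto simp: find_threshold_def)

context strictly_convex_plane begin

lemma cross2_tip_nonneg: "0 \<le> cross2 tip v \<longleftrightarrow> snd tip * fst v \<le> fst tip * snd v"
  by (cases tip; cases v) simp

text \<open>On an empty stack the index \<open>k - 1\<close> is 0 by truncated subtraction, and the equation is still true.\<close>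

lemma rv_find_threshold:
  assumes "rv s ''w'' = fst tip" "rv s ''e'' = snd tip"
  shows "rv (eff N find_threshold s) ''t'' =
    threshold (ra s ''sx'' (iv s ''k'' - 1), ra s ''sy'' (iv s ''k'' - 1)) (rv s ''u'', rv s ''v'')"
  using assms
  by (simp add: find_threshold_def common_upper_def stack_top_def store_points_def threshold_def
      Let_def upper_common_def cross2_tip_nonneg default_threshold_def numeral_2_eq_2)

lemma find_tip_eff:
  shows "rv (eff N find_tip s) ''w'' = fst tip" "rv (eff N find_tip s) ''e'' = snd tip"
proof -
  define us where "us = enum_points (touch_points N 0 1 (0, 1))"
  have us: "set us = {tip, - tip}" "length us = card {tip, - tip}"
    using enum_points_set[of "{tip, - tip}"] by (auto simp: us_def touch_points_vertical)
  have len: "0 < length us" using us(1) by (cases us) auto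
  then have "us ! 0 \<in> set us" by simp
  then have "us ! 0 \<in> {tip, - tip}" unfolding us(1) .
  then show "rv (eff N find_tip s) ''w'' = fst tip" "rv (eff N find_tip s) ''e'' = snd tip"
    using fst_tip_pos len
    by (auto simp: find_tip_def store_points_def us_def[symmetric] zero_prod_def[symmetric])
qed

end

lemma loop_free_steps:
  "loop_free build_step" "loop_free query_step" "loop_free sort_step" "loop_free reflect_step"
  "loop_free scan_step" "loop_free find_tip"
  by (simp_all add: build_step_def query_step_def sort_step_def reflect_step_def scan_step_def
      find_tip_def load_def push_def loop_free_find_threshold find_threshold_def)

text \<open>A block of \<open>n\<close> points sorted by abscissa, starting at index \<open>off\<close>, together with the large disc
around \<open>c\<close> of radius \<open>r\<close>.\<close>

locale envelope_pass = strictly_convex_plane +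
  fixes n off :: nat and X Y :: "nat \<Rightarrow> real" and c :: point and r :: real
  assumes sorted: "i \<le> j \<Longrightarrow> j < n \<Longrightarrow> X (off + i) \<le> X (off + j)"
begin

definition "pt i = (X (off + i), Y (off + i))"
definition "far i \<longleftrightarrow> r < N (pt i - c)"
text \<open>The common domain of the boundaries of all far points. Only there do thresholds say anything, and only queries
from there can succeed.\<close>

definition "strip = {x. \<forall>i<n. far i \<longrightarrow> \<bar>x - fst (pt i)\<bar> \<le> fst tip}"

lemma pt_mono: "i \<le> j \<Longrightarrow> j < n \<Longrightarrow> fst (pt i) \<le> fst (pt j)"
  using sorted by (simp add: pt_def)

text \<open>Thresholds decrease towards the top: the top has the lowest boundary at the far left, and each element below
it takes over when \<open>x\<close> reaches the threshold between them.\<close>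

definition ordered_stack :: "nat \<Rightarrow> (nat \<Rightarrow> point) \<Rightarrow> (nat \<Rightarrow> real) \<Rightarrow> bool" where
  "ordered_stack k S T \<longleftrightarrow>
     (\<forall>l. Suc l < k \<longrightarrow> (\<forall>x\<in>strip.
        (T (Suc l) \<le> x \<longrightarrow> boundary (S l) x \<le> boundary (S (Suc l)) x) \<and>
        (x < T (Suc l) \<longrightarrow> boundary (S (Suc l)) x \<le> boundary (S l) x))) \<and>
     (\<forall>l. Suc (Suc l) < k \<longrightarrow> T (Suc (Suc l)) < T (Suc l))"

lemma ordered_stack_pop: "ordered_stack k S T \<Longrightarrow> ordered_stack (k - 1) S T"
  by (auto simp: ordered_stack_def)

lemma top_minimal:
  assumes "ordered_stack k S T" "x \<in> strip" "2 \<le> k \<longrightarrow> x < T (k - 1)" "l < k"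
  shows "boundary (S (k - 1)) x \<le> boundary (S l) x"
proof -
  have lt: "x < T m" if "m \<le> k - 1" "1 \<le> m" for m
    using that
  proof (induction rule: inc_induct)
    case base
    then show ?case using assms by simp
  next
    case (step m)
    obtain m' where m': "m = Suc m'" using step.prems by (cases m) auto
    then have "T (Suc m) < T m" using assms(1) step.hyps by (auto simp: ordered_stack_def)
    then show ?case using step by simp
  qed
  have "l \<le> k - 1" using assms by simp
  then show ?thesis
  proof (induction rule: inc_induct)
    case (step m)
    then have "boundary (S (Suc m)) x \<le> boundary (S m) x"
      using assms(1,2) lt[of "Suc m"] by (auto simp: ordered_stack_def)
    then show ?case using step by simp
  qed simp
qed

text \<open>With an empty stack there are no far points, hence no first and last one. The stack never becomes empty
again after the first push, because elements are popped only from stacks of height at least 2.\<close>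

definition ends :: "nat \<Rightarrow> nat \<Rightarrow> point \<Rightarrow> point \<Rightarrow> bool" where
  "ends i k a b \<longleftrightarrow> (if k = 0 then \<forall>i'<i. \<not> far i'
     else (\<exists>i'<i. far i' \<and> a = pt i') \<and> (\<exists>i'<i. far i' \<and> b = pt i') \<and>
       (\<forall>i'<i. far i' \<longrightarrow> fst a \<le> fst (pt i') \<and> fst (pt i') \<le> fst b))"

text \<open>The invariant of the construction after \<open>i\<close> points: the stack realizes the minimum of the boundaries of
all far points seen so far. While elements are being popped in favour of point \<open>i\<close>, that point itself
takes part in the minimum, although it is not on the stack yet.\<close>

definition envelope :: "nat \<Rightarrow> nat \<Rightarrow> (nat \<Rightarrow> point) \<Rightarrow> (nat \<Rightarrow> real) \<Rightarrow> bool" where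
  "envelope i k S T \<longleftrightarrow> k \<le> i \<and> i \<le> n \<and> ordered_stack k S T \<and>
     (\<forall>l<k. \<exists>i'<i. far i' \<and> S l = pt i') \<and>
     (\<forall>i'<i. far i' \<longrightarrow> (\<forall>x\<in>strip. (\<exists>l<k. boundary (S l) x \<le> boundary (pt i') x) \<or>
        (i < n \<and> far i \<and> boundary (pt i) x \<le> boundary (pt i') x)))"

lemma envelope_element: "envelope i k S T \<Longrightarrow> l < k \<Longrightarrow> \<exists>i'<i. far i' \<and> S l = pt i'"
  by (simp add: envelope_def)

lemma envelope_covers:
  "envelope i k S T \<Longrightarrow> i' < i \<Longrightarrow> far i' \<Longrightarrow> x \<in> strip \<Longrightarrow>
    (\<exists>l<k. boundary (S l) x \<le> boundary (pt i') x) \<or>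
    (i < n \<and> far i \<and> boundary (pt i) x \<le> boundary (pt i') x)"
  by (simp add: envelope_def)

lemma separates_strip:
  assumes "separates (pt i) (pt j) t" "far i" "far j" "i < n" "j < n" "x \<in> strip"
  shows "t \<le> x \<Longrightarrow> boundary (pt i) x \<le> boundary (pt j) x"
    and "x < t \<Longrightarrow> boundary (pt j) x \<le> boundary (pt i) x"
proof -
  have "\<bar>x - fst (pt i)\<bar> \<le> fst tip" "\<bar>x - fst (pt j)\<bar> \<le> fst tip"
    using assms by (auto simp: strip_def)
  then have "fst (pt j) - fst tip \<le> x" "x \<le> fst (pt i) + fst tip" by linarith+
  then show "t \<le> x \<Longrightarrow> boundary (pt i) x \<le> boundary (pt j) x"
    and "x < t \<Longrightarrow> boundary (pt j) x \<le> boundary (pt i) x"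
    using assms(1) by (auto simp: separates_def)
qed

lemma envelope_skip:
  assumes "envelope i k S T" "i < n" "\<not> far i"
  shows "envelope (Suc i) k S T"
  using assms unfolding envelope_def by (auto simp: less_Suc_eq) 

text \<open>To the right of its own threshold the top is not lower than the element below it; to the left of the new
threshold it is not lower than the new point. If the new threshold is not the smaller one, the two ranges
together cover the strip.\<close>

lemma envelope_pop:
  assumes env: "envelope i k S T" and "i < n" "far i" "2 \<le> k" "T (k - 1) \<le> t"
    and sep: "separates (S (k - 1)) (pt i) t"
  shows "envelope i (k - 1) S T"
proof -
  obtain m where k: "k = Suc (Suc m)" using assms(4) by (metis add_2_eq_Suc le_Suc_ex)
  have "(\<exists>l<k - 1. boundary (S l) x \<le> boundary (pt i') x) \<or> boundary (pt i) x \<le> boundary (pt i') x"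
    if i': "i' < i" "far i'" "x \<in> strip" for i' x
  proof -
    from envelope_covers[OF env i'] consider l where "l < k" "boundary (S l) x \<le> boundary (pt i') x"
      | "boundary (pt i) x \<le> boundary (pt i') x"
      by blast
    then show ?thesis
    proof cases
      case 1
      show ?thesis
      proof (cases "l < k - 1")
        case False
        then have l: "l = Suc m" using 1 k by simp
        show ?thesis
        proof (cases "T (Suc m) \<le> x")
          case True
          then have "boundary (S m) x \<le> boundary (S (Suc m)) x"
            using env k i'(3) by (simp add: envelope_def ordered_stack_def)
          then show ?thesis using 1 l k by (intro disjI1 exI[of _ m]) simp
        next
          case False
          obtain j where j: "j < i" "far j" "S (Suc m) = pt j"
            using envelope_element[OF env, of "Suc m"] k by auto
          have "x < t" using False assms(5) k by simp
          then have "boundary (pt i) x \<le> boundary (pt j) x"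
            using separates_strip(2)[of j i t x] sep j assms(2,3) i'(3) k by simp
          then show ?thesis using 1 l j by simp
        qed
      qed (use 1 in blast)
    qed blast
  qed
  then show ?thesis using env assms(2,3) ordered_stack_pop by (auto simp: envelope_def)
qed

lemma envelope_push:
  assumes env: "envelope i k S T" and i: "i < n" "far i"
    and t: "2 \<le> k \<longrightarrow> t < T (k - 1)" "1 \<le> k \<longrightarrow> separates (S (k - 1)) (pt i) t"
  shows "envelope (Suc i) (Suc k) (S(k := pt i)) (T(k := t))"
proof -
  have "ordered_stack (Suc k) (S(k := pt i)) (T(k := t))"
  proof -
    have "(T(k := t)) (Suc l) \<le> x \<longrightarrow> boundary ((S(k := pt i)) l) x \<le> boundary ((S(k := pt i)) (Suc l)) x"
         "x < (T(k := t)) (Suc l) \<longrightarrow> boundary ((S(k := pt i)) (Suc l)) x \<le> boundary ((S(k := pt i)) l) x"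
      if l: "Suc l < Suc k" and x: "x \<in> strip" for l x
    proof (atomize (full), cases "Suc l = k")
      case True
      obtain j where j: "j < i" "far j" "S l = pt j"
        using envelope_element[OF env, of l] True by auto
      then show "((T(k := t)) (Suc l) \<le> x \<longrightarrow> boundary ((S(k := pt i)) l) x \<le> boundary ((S(k := pt i)) (Suc l)) x) \<and>
         (x < (T(k := t)) (Suc l) \<longrightarrow> boundary ((S(k := pt i)) (Suc l)) x \<le> boundary ((S(k := pt i)) l) x)"
        using separates_strip[of j i t x] t(2) True i x by auto
    next
      case False
      then show "((T(k := t)) (Suc l) \<le> x \<longrightarrow> boundary ((S(k := pt i)) l) x \<le> boundary ((S(k := pt i)) (Suc l)) x) \<and>
         (x < (T(k := t)) (Suc l) \<longrightarrow> boundary ((S(k := pt i)) (Suc l)) x \<le> boundary ((S(k := pt i)) l) x)"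
        using env l x by (auto simp: envelope_def ordered_stack_def)
    qed
    moreover have "(T(k := t)) (Suc (Suc l)) < (T(k := t)) (Suc l)" if "Suc (Suc l) < Suc k" for l
      using env that t(1) by (cases "Suc (Suc l) = k") (auto simp: envelope_def ordered_stack_def)
    ultimately show ?thesis unfolding ordered_stack_def by blast
  qed
  moreover have "\<exists>l<Suc k. boundary ((S(k := pt i)) l) x \<le> boundary (pt i') x"
    if i': "i' < Suc i" "far i'" "x \<in> strip" for i' x
  proof (cases "i' = i")
    case True
    then show ?thesis by (intro exI[of _ k]) simp
  next
    case False
    then have "i' < i" using i' by simp
    from envelope_covers[OF env this i'(2,3)]
    consider l where "l < k" "boundary (S l) x \<le> boundary (pt i') x"
      | "boundary (pt i) x \<le> boundary (pt i') x"
      by blast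
    then show ?thesis
    proof cases
      case 1
      then show ?thesis by (intro exI[of _ l]) simp
    next
      case 2
      then show ?thesis by (intro exI[of _ k]) simp
    qed
  qed
  moreover have "\<exists>i'<Suc i. far i' \<and> (S(k := pt i)) l = pt i'" if "l < Suc k" for l
  proof (cases "l = k")
    case False
    then have "l < k" using that by simp
    from envelope_element[OF env this]
    obtain i' where "i' < i" "far i'" "S l = pt i'"
      by blast
    then show ?thesis using False by (intro exI[of _ i']) simp
  qed (use i in auto)
  ultimately show ?thesis using env i unfolding envelope_def by auto
qed

lemma ends_skip: "ends i k a b \<Longrightarrow> \<not> far i \<Longrightarrow> ends (Suc i) k a b"
  by (auto simp: ends_def less_Suc_eq split: if_splits)

lemma ends_pop: "ends i k a b \<Longrightarrow> 2 \<le> k \<Longrightarrow> ends i (k - 1) a b"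
  by (auto simp: ends_def)

lemma ends_push:
  assumes "ends i k a b" "far i" "i < n"
  shows "ends (Suc i) (Suc k) (if k = 0 then pt i else a) (pt i)"
proof (cases "k = 0")
  case True
  then show ?thesis using assms by (auto simp: ends_def less_Suc_eq)
next
  case False
  obtain j where "j < i" "far j" "a = pt j" using assms(1) False by (auto simp: ends_def)
  then have "fst a \<le> fst (pt i)" using pt_mono[of j i] assms(3) by simp
  then show ?thesis using assms False pt_mono[of _ i]
    by (auto simp: ends_def less_Suc_eq)
qed

text \<open>A pass sees upper boundaries only, so its answer is one-sided: it may pass points below the lower boundary of
some disc, but it never fails a point that lies in all the discs.\<close>

definition verdict :: "nat \<Rightarrow> nat \<Rightarrow> bool" where
  "verdict j b \<longleftrightarrow>
     (b = 0 \<longrightarrow> (\<forall>i<n. far i \<longrightarrow> \<bar>fst (pt j) - fst (pt i)\<bar> \<le> fst tip \<and>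
        snd (pt j) \<le> boundary (pt i) (fst (pt j)))) \<and>
     ((\<forall>i<n. far i \<longrightarrow> N (pt j - pt i) \<le> 1) \<longrightarrow> b = 0)"

text \<open>The invariant of the queries: as they come in ascending order, the stack has to be right only at and to the right of
the next query.\<close>

definition pending :: "nat \<Rightarrow> nat \<Rightarrow> (nat \<Rightarrow> point) \<Rightarrow> (nat \<Rightarrow> real) \<Rightarrow> bool" where
  "pending j k S T \<longleftrightarrow> j \<le> n \<and> k \<le> n \<and> ordered_stack k S T \<and>
     (\<forall>l<k. \<exists>i'<n. far i' \<and> S l = pt i') \<and>
     (\<forall>i'<n. far i' \<longrightarrow> (\<forall>x\<in>strip. j < n \<and> fst (pt j) \<le> x \<longrightarrow>
        (\<exists>l<k. boundary (S l) x \<le> boundary (pt i') x)))"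

lemma pending_element: "pending j k S T \<Longrightarrow> l < k \<Longrightarrow> \<exists>i<n. far i \<and> S l = pt i"
  by (simp add: pending_def)

lemma pending_covers:
  "pending j k S T \<Longrightarrow> i < n \<Longrightarrow> far i \<Longrightarrow> x \<in> strip \<Longrightarrow> j < n \<Longrightarrow> fst (pt j) \<le> x \<Longrightarrow>
    \<exists>l<k. boundary (S l) x \<le> boundary (pt i) x"
  by (simp add: pending_def)

lemma envelope_pending: "envelope n k S T \<Longrightarrow> pending 0 k S T"
  by (auto simp: envelope_def pending_def)

lemma pending_pop:
  assumes p: "pending j k S T" and "j < n" "2 \<le> k" "T (k - 1) \<le> fst (pt j)"
  shows "pending j (k - 1) S T"
proof -
  obtain m where k: "k = Suc (Suc m)" using assms(3) by (metis add_2_eq_Suc le_Suc_ex)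
  have "\<exists>l<k - 1. boundary (S l) x \<le> boundary (pt i') x"
    if i': "i' < n" "far i'" "x \<in> strip" "fst (pt j) \<le> x" for i' x
  proof -
    obtain l where l: "l < k" "boundary (S l) x \<le> boundary (pt i') x"
      using pending_covers[OF p i'(1,2,3) assms(2) i'(4)] by blast
    show ?thesis
    proof (cases "l < k - 1")
      case False
      then have "l = Suc m" using l k by simp
      moreover have "boundary (S m) x \<le> boundary (S (Suc m)) x"
        using p k i' assms(4) by (simp add: pending_def ordered_stack_def)
      ultimately show ?thesis using l k by (intro exI[of _ m]) simp
    qed (use l in blast)
  qed
  then show ?thesis using p assms(2) ordered_stack_pop by (auto simp: pending_def)
qed

lemma pending_next:
  assumes "pending j k S T" "j < n"
  shows "pending (Suc j) k S T"
proof -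
  have "fst (pt j) \<le> x" if "Suc j < n \<and> fst (pt (Suc j)) \<le> x" for x
    using that pt_mono[of j "Suc j"] by simp
  then show ?thesis using assms unfolding pending_def by (meson Suc_leI)
qed

text \<open>Closeness to the extreme far points bounds the horizontal distance to all far points, since their abscissas
are in between. So the abscissa of the query is in the strip, where the top of the stack has the lowest
boundary, and the query is below that boundary because it is in the disc.\<close>

lemma pending_verdict:
  assumes p: "pending j k S T" and e: "ends n k a b" and j: "j < n"
    and top: "2 \<le> k \<longrightarrow> fst (pt j) < T (k - 1)"
  shows "verdict j (if 1 \<le> k \<and> \<not> (N (pt j - S (k - 1)) \<le> 1 \<and> N (pt j - a) \<le> 1 \<and> N (pt j - b) \<le> 1)
    then 1 else 0)"
proof (cases "k = 0")
  case True
  then show ?thesis using e by (auto simp: verdict_def ends_def)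
next
  case False
  obtain ia ib where ab: "ia < n" "far ia" "a = pt ia" "ib < n" "far ib" "b = pt ib"
    using e False by (auto simp: ends_def)
  obtain it where it: "it < n" "far it" "S (k - 1) = pt it"
    using pending_element[OF p, of "k - 1"] False by auto
  have "\<bar>fst (pt j) - fst (pt i)\<bar> \<le> fst tip \<and> snd (pt j) \<le> boundary (pt i) (fst (pt j))"
    if n: "N (pt j - S (k - 1)) \<le> 1" "N (pt j - a) \<le> 1" "N (pt j - b) \<le> 1"
      and i: "i < n" "far i" for i
  proof -
    have "\<bar>fst (pt j) - fst a\<bar> \<le> fst tip" "\<bar>fst (pt j) - fst b\<bar> \<le> fst tip"
      using fst_le_tip[OF n(2)] fst_le_tip[OF n(3)] by auto
    then have strip: "\<bar>fst (pt j) - fst (pt i)\<bar> \<le> fst tip" if "i < n" "far i" for i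
      using e False that unfolding ends_def by (smt (verit))
    then have s: "fst (pt j) \<in> strip" by (simp add: strip_def)
    then obtain l where l: "l < k" "boundary (S l) (fst (pt j)) \<le> boundary (pt i) (fst (pt j))"
      using pending_covers[OF p i s j] by blast
    have "snd (pt j) \<le> boundary (S (k - 1)) (fst (pt j))" by (rule below_boundary[OF n(1)])
    also have "\<dots> \<le> boundary (S l) (fst (pt j))"
      using p by (intro top_minimal[where T = T] s top l(1)) (simp add: pending_def)
    finally show ?thesis using strip[OF i] l(2) by simp
  qed
  then show ?thesis using False ab it by (auto simp: verdict_def)
qed

end

section \<open>One pass over a block of points\<close>

context envelope_pass begin

text \<open>The variables of the program hold the parameters of the locale.\<close>

definition env :: "state \<Rightarrow> bool" where
  "env s \<longleftrightarrow> iv s ''n'' = n \<and> iv s ''o'' = off \<and> ra s ''x'' = X \<and> ra s ''y'' = Y \<and>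
     rv s ''r'' = r \<and> (rv s ''c'', rv s ''d'') = c \<and> (rv s ''w'', rv s ''e'') = tip"

definition stk :: "state \<Rightarrow> nat \<Rightarrow> point" where
  "stk s l = (ra s ''sx'' l, ra s ''sy'' l)"

definition build_inv :: "(nat \<Rightarrow> nat) \<Rightarrow> state \<Rightarrow> bool" where
  "build_inv bad s \<longleftrightarrow> env s \<and> envelope (iv s ''i'') (iv s ''k'') (stk s) (ra s ''st'') \<and>
     ends (iv s ''i'') (iv s ''k'') (rv s ''f'', rv s ''g'') (rv s ''a'', rv s ''b'') \<and>
     ia s ''bad'' = bad"

text \<open>A step that moves on to the next point may push an element, hence the factor 2 in the measure.\<close>

lemma build_step_inv:
  assumes inv: "build_inv bad s" and lt: "iv s ''i'' < n"
  shows "build_inv bad (eff N build_step s) \<and>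
    2 * (n - iv (eff N build_step s) ''i'') + iv (eff N build_step s) ''k''
      < 2 * (n - iv s ''i'') + iv s ''k''"
proof -
  define i k where "i = iv s ''i''" and "k = iv s ''k''"
  define s1 where "s1 = eff N (load ''i'') s"
  define s2 where "s2 = eff N find_threshold s1"
  define s' where "s' = eff N build_step s"
  have env: "env s" and envl: "envelope i k (stk s) (ra s ''st'')"
    and ends: "ends i k (rv s ''f'', rv s ''g'') (rv s ''a'', rv s ''b'')" and bad: "ia s ''bad'' = bad"
    using inv by (auto simp: build_inv_def i_def k_def)
  have w: "rv s ''w'' = fst tip" "rv s ''e'' = snd tip" "rv s ''c'' = fst c" "rv s ''d'' = snd c"
    using env by (auto simp: env_def simp flip: prod_eq_iff) (metis fst_conv snd_conv)+
  have i: "i < n" using lt by (simp add: i_def)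
  have s1: "s1 = s\<lparr>rv := (rv s)(''u'' := fst (pt i), ''v'' := snd (pt i))\<rparr>"
    using env by (simp add: s1_def load_def env_def pt_def i_def)
  have t: "rv s2 ''t'' = threshold (stk s (k - 1)) (pt i)"
    unfolding s2_def by (subst rv_find_threshold) (simp_all add: s1 w stk_def k_def)
  have fr: "x \<notin> {''m'', ''ix'', ''iy'', ''t''} \<Longrightarrow>
      iv s2 x = iv s1 x \<and> rv s2 x = rv s1 x \<and> ia s2 x = ia s1 x \<and> ra s2 x = ra s1 x" for x
    unfolding s2_def using eff_frame[OF loop_free_find_threshold] writes_find_threshold by simp
  have s': "s' = (if \<not> far i then s1\<lparr>iv := (iv s1)(''i'' := Suc i)\<rparr>
      else if 2 \<le> k \<and> ra s ''st'' (k - 1) \<le> rv s2 ''t'' then s2\<lparr>iv := (iv s2)(''k'' := k - 1)\<rparr>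
      else eff N push s2)"
  proof -
    have "bval N (distance_le current (RVar ''c'', RVar ''d'') (RVar ''r'')) s1 \<longleftrightarrow> \<not> far i"
      using env w by (simp add: s1 far_def env_def minus_prod_def not_less)
    moreover have "bval N (stack_guard (RVar ''t'')) s2 \<longleftrightarrow> 2 \<le> k \<and> ra s ''st'' (k - 1) \<le> rv s2 ''t''"
      by (simp add: stack_guard_def fr s1 k_def)
    moreover have "eff N (succ ''i'') s1 = s1\<lparr>iv := (iv s1)(''i'' := Suc i)\<rparr>"
      "eff N pop s2 = s2\<lparr>iv := (iv s2)(''k'' := k - 1)\<rparr>"
      by (simp_all add: s1 i_def fr k_def)
    moreover have "s' = (if bval N (distance_le current (RVar ''c'', RVar ''d'') (RVar ''r'')) s1
        then eff N (succ ''i'') s1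
        else if bval N (stack_guard (RVar ''t'')) s2 then eff N pop s2 else eff N push s2)"
      by (simp only: s'_def build_step_def eff.simps(8,9) s1_def s2_def)
    ultimately show ?thesis by simp
  qed
  show ?thesis
  proof (cases "far i")
    case False
    have "envelope (Suc i) k (stk s) (ra s ''st'')" by (rule envelope_skip[OF envl i False])
    moreover have "stk s' = stk s" using False by (simp add: s' s1 stk_def fun_eq_iff)
    ultimately show ?thesis
      using False env bad ends_skip[OF ends False] i
      by (fold s'_def) (simp add: s' s1 build_inv_def env_def i_def k_def)
  next
    case far: True
    have sep: "separates (stk s (k - 1)) (pt i) (rv s2 ''t'')" if "1 \<le> k"
    proof -
      have "k - 1 < k" using that by simp
      from envelope_element[OF envl this] obtain j where "j < i" "stk s (k - 1) = pt j" by blast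
      then show ?thesis unfolding t using pt_mono[of j i] i by (auto intro: threshold_separates)
    qed
    show ?thesis
    proof (cases "2 \<le> k \<and> ra s ''st'' (k - 1) \<le> rv s2 ''t''")
      case True
      then have "envelope i (k - 1) (stk s) (ra s ''st'')"
        using sep by (intro envelope_pop[OF envl i far]) auto
      moreover have "stk s' = stk s" using far True by (simp add: s' fr s1 stk_def fun_eq_iff)
      ultimately show ?thesis
        using far True env bad ends_pop[OF ends]
        by (fold s'_def) (simp add: s' s1 fr build_inv_def env_def i_def k_def)
    next
      case False
      have "envelope (Suc i) (Suc k) ((stk s)(k := pt i)) ((ra s ''st'')(k := rv s2 ''t''))"
        using sep False by (intro envelope_push[OF envl i far]) auto
      moreover have s'_push: "s' = eff N push s2" using s' far False by presburger
      moreover have k: "iv s2 ''k'' = k" "iv s2 ''i'' = i" by (simp_all add: fr s1 k_def i_def)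
      moreover have "stk s' = (stk s)(k := pt i)" "ra s' ''st'' = (ra s ''st'')(k := rv s2 ''t'')"
        by (auto simp: s'_push push_def fr s1 stk_def k fun_eq_iff)
      moreover have "ends (Suc i) (Suc k) (rv s' ''f'', rv s' ''g'') (rv s' ''a'', rv s' ''b'')"
        using ends_push[OF ends far i] by (cases "k = 0") (simp_all add: s'_push push_def fr s1 k)
      moreover have "env s'" "iv s' ''i'' = Suc i" "iv s' ''k'' = Suc k" "ia s' ''bad'' = bad"
        using env bad by (simp_all add: s'_push push_def fr s1 k env_def)
      ultimately show ?thesis
        using i by (fold s'_def i_def k_def) (simp add: build_inv_def)
    qed
  qed
qed

definition query_inv :: "(nat \<Rightarrow> nat) \<Rightarrow> state \<Rightarrow> bool" where
  "query_inv bad s \<longleftrightarrow> env s \<and> pending (iv s ''j'') (iv s ''k'') (stk s) (ra s ''st'') \<and>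
     ends n (iv s ''k'') (rv s ''f'', rv s ''g'') (rv s ''a'', rv s ''b'') \<and>
     (\<forall>j < iv s ''j''. verdict j (ia s ''bad'' (off + j))) \<and>
     (\<forall>q. q < off \<or> off + n \<le> q \<longrightarrow> ia s ''bad'' q = bad q)"

lemma query_step_inv:
  assumes inv: "query_inv bad s" and lt: "iv s ''j'' < n"
  shows "query_inv bad (eff N query_step s) \<and>
    (n - iv (eff N query_step s) ''j'') + iv (eff N query_step s) ''k''
      < (n - iv s ''j'') + iv s ''k''"
proof -
  define j k where "j = iv s ''j''" and "k = iv s ''k''"
  define f a where "f = (rv s ''f'', rv s ''g'')" and "a = (rv s ''a'', rv s ''b'')"
  define s1 where "s1 = eff N (load ''j'') s"
  define s' where "s' = eff N query_step s"
  define flag :: nat where "flag = (if 1 \<le> k \<and> \<not> (N (pt j - stk s (k - 1)) \<le> 1 \<and>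
     N (pt j - f) \<le> 1 \<and> N (pt j - a) \<le> 1) then 1 else 0)"
  have env: "env s" and pend: "pending j k (stk s) (ra s ''st'')" and ends: "ends n k f a"
    and verdicts: "\<forall>j' < j. verdict j' (ia s ''bad'' (off + j'))"
    and rest: "\<forall>q. q < off \<or> off + n \<le> q \<longrightarrow> ia s ''bad'' q = bad q"
    using inv by (auto simp: query_inv_def j_def k_def f_def a_def)
  have j: "j < n" using lt by (simp add: j_def)
  have s1: "s1 = s\<lparr>rv := (rv s)(''u'' := fst (pt j), ''v'' := snd (pt j))\<rparr>"
    using env by (simp add: s1_def load_def env_def pt_def j_def)
  have s': "s' = (if 2 \<le> k \<and> ra s ''st'' (k - 1) \<le> fst (pt j) then s1\<lparr>iv := (iv s1)(''k'' := k - 1)\<rparr>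
      else s1\<lparr>iv := (iv s1)(''j'' := Suc j), ia := (ia s1)(''bad'' := (ia s1 ''bad'')(off + j := flag))\<rparr>)"
  proof -
    define test where "test = BAnd (ILe (ICon 1) (IVar ''k''))
        (BNot (BAnd (distance_le current stack_top (RCon 1))
          (BAnd (distance_le current (RVar ''f'', RVar ''g'') (RCon 1))
                (distance_le current (RVar ''a'', RVar ''b'') (RCon 1)))))"
    have "bval N (stack_guard (RVar ''u'')) s1 \<longleftrightarrow> 2 \<le> k \<and> ra s ''st'' (k - 1) \<le> fst (pt j)"
      by (simp add: stack_guard_def s1 k_def)
    moreover have "bval N test s1 \<longleftrightarrow> flag = 1"
      by (simp add: test_def s1 flag_def f_def a_def k_def stack_top_def stk_def minus_prod_def)
    moreover have "flag = 0 \<or> flag = 1" by (simp add: flag_def)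
    moreover have "eff N pop s1 = s1\<lparr>iv := (iv s1)(''k'' := k - 1)\<rparr>" by (simp add: s1 k_def)
    moreover have "eff N (succ ''j'') (eff N (IStore ''bad'' (IAdd (IVar ''o'') (IVar ''j'')) (ICon h)) s1) =
        s1\<lparr>iv := (iv s1)(''j'' := Suc j), ia := (ia s1)(''bad'' := (ia s1 ''bad'')(off + j := h))\<rparr>" for h
      using env by (simp add: s1 j_def env_def)
    moreover have "s' = (if bval N (stack_guard (RVar ''u'')) s1 then eff N pop s1
        else eff N (succ ''j'') (if bval N test s1
          then eff N (IStore ''bad'' (IAdd (IVar ''o'') (IVar ''j'')) (ICon 1)) s1
          else eff N (IStore ''bad'' (IAdd (IVar ''o'') (IVar ''j'')) (ICon 0)) s1))"
      by (simp only: s'_def query_step_def eff.simps(8,9) s1_def test_def)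
    ultimately show ?thesis by auto
  qed
  show ?thesis
  proof (cases "2 \<le> k \<and> ra s ''st'' (k - 1) \<le> fst (pt j)")
    case True
    then have "pending j (k - 1) (stk s) (ra s ''st'')"
      by (intro pending_pop[OF pend j]) auto
    moreover have "stk s' = stk s" using True by (simp add: s' s1 stk_def fun_eq_iff)
    ultimately show ?thesis
      using True env verdicts rest ends_pop[OF ends]
      by (fold s'_def) (simp add: s' s1 query_inv_def env_def j_def k_def f_def a_def)
  next
    case False
    have "verdict j flag" unfolding flag_def
      by (rule pending_verdict[OF pend ends j]) (use False in auto)
    then have "\<forall>j' < Suc j. verdict j' (((ia s ''bad'')(off + j := flag)) (off + j'))"
      using verdicts by (simp add: less_Suc_eq)
    moreover have "pending (Suc j) k (stk s) (ra s ''st'')" by (rule pending_next[OF pend j])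
    moreover have s'_next: "s' = s1\<lparr>iv := (iv s1)(''j'' := Suc j), ia := (ia s1)(''bad'' := (ia s1 ''bad'')(off + j := flag))\<rparr>"
      using s' False by presburger
    moreover have "stk s' = stk s" by (simp add: s'_next s1 stk_def fun_eq_iff)
    moreover have "iv s ''j'' = j" "iv s ''k'' = k" by (simp_all add: j_def k_def)
    ultimately show ?thesis
      using env rest ends j
      by (fold s'_def) (simp add: s1 query_inv_def env_def f_def a_def)
  qed
qed

end

text \<open>Both loops start with a measure of at most \<open>2 * n\<close>.\<close>

definition pass_cost :: "nat \<Rightarrow> nat" where
  "pass_cost n = 10 + (6 + max_cost build_step) * (2 * n + 1) + (6 + max_cost query_step) * (2 * n + 1)"

lemma (in envelope_pass) pass_correct:
  assumes "env s"
  shows "achieves N pass s (pass_cost n) (\<lambda>s'. (\<forall>j<n. verdict j (ia s' ''bad'' (off + j))) \<and>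
    (\<forall>q. q < off \<or> off + n \<le> q \<longrightarrow> ia s' ''bad'' q = ia s ''bad'' q))"
proof -
  define bad where "bad = ia s ''bad''"
  define s0 where "s0 = eff N (ISet ''k'' (ICon 0)) (eff N (ISet ''i'' (ICon 0)) s)"
  have s0: "build_inv bad s0"
    using assms by (simp add: s0_def build_inv_def env_def bad_def envelope_def ordered_stack_def ends_def)
  have "achieves N (While (below ''i'' ''n'') build_step) s0
      ((6 + max_cost build_step) * (2 * n + 1)) (\<lambda>s. build_inv bad s \<and> iv s ''i'' = n)"
  proof (rule achieves_weaken[OF achieves_while[where I = "build_inv bad" and B = "max_cost build_step"
        and \<mu> = "\<lambda>s. 2 * (n - iv s ''i'') + iv s ''k''"]])
    fix s assume "build_inv bad s" "bval N (below ''i'' ''n'') s"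
    then show "achieves N build_step s (max_cost build_step) (\<lambda>s'. build_inv bad s' \<and>
        2 * (n - iv s' ''i'') + iv s' ''k'' < 2 * (n - iv s ''i'') + iv s ''k'')"
      by (intro achieves_loop_free loop_free_steps build_step_inv) (auto simp: build_inv_def env_def)
  next
    show "(1 + bcost (below ''i'' ''n'') + max_cost build_step) * (2 * (n - iv s0 ''i'') + iv s0 ''k'' + 1)
        \<le> (6 + max_cost build_step) * (2 * n + 1)"
      by (intro mult_le_mono) (simp_all add: s0_def)
  qed (use s0 in \<open>auto simp: build_inv_def env_def envelope_def\<close>)
  moreover have "achieves N (Seq (ISet ''j'' (ICon 0)) (While (below ''j'' ''n'') query_step)) s
      (3 + (6 + max_cost query_step) * (2 * n + 1)) (\<lambda>s. query_inv bad s \<and> iv s ''j'' = n)"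
    if "build_inv bad s \<and> iv s ''i'' = n" for s
  proof -
    define s1 where "s1 = eff N (ISet ''j'' (ICon 0)) s"
    have stk: "stk s1 = stk s" by (simp add: s1_def stk_def fun_eq_iff)
    have "envelope n (iv s ''k'') (stk s) (ra s ''st'')" using that unfolding build_inv_def by metis
    from envelope_pending[OF this] have s1: "query_inv bad s1"
      using that by (simp add: query_inv_def stk) (auto simp: s1_def build_inv_def env_def)
    then have k: "iv s1 ''k'' \<le> n" by (simp add: query_inv_def pending_def)
    have "achieves N (While (below ''j'' ''n'') query_step) s1
        ((6 + max_cost query_step) * (2 * n + 1)) (\<lambda>s. query_inv bad s \<and> iv s ''j'' = n)"
    proof (rule achieves_weaken[OF achieves_while[where I = "query_inv bad" and B = "max_cost query_step"
          and \<mu> = "\<lambda>s. (n - iv s ''j'') + iv s ''k''"]])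
      fix s assume "query_inv bad s" "bval N (below ''j'' ''n'') s"
      then show "achieves N query_step s (max_cost query_step) (\<lambda>s'. query_inv bad s' \<and>
          (n - iv s' ''j'') + iv s' ''k'' < (n - iv s ''j'') + iv s ''k'')"
        by (intro achieves_loop_free loop_free_steps query_step_inv) (auto simp: query_inv_def env_def)
    next
      show "(1 + bcost (below ''j'' ''n'') + max_cost query_step) * ((n - iv s1 ''j'') + iv s1 ''k'' + 1)
          \<le> (6 + max_cost query_step) * (2 * n + 1)"
        using k by (intro mult_le_mono) simp_all
    qed (use s1 in \<open>auto simp: query_inv_def env_def pending_def\<close>)
    from achieves_loop_free_seq[OF _ this[unfolded s1_def]] show ?thesis
      by (rule achieves_weaken) simp_all
  qed
  ultimately have "achieves N (Seq (While (below ''i'' ''n'') build_step)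
      (Seq (ISet ''j'' (ICon 0)) (While (below ''j'' ''n'') query_step))) s0
      (1 + (6 + max_cost build_step) * (2 * n + 1) + (3 + (6 + max_cost query_step) * (2 * n + 1)))
      (\<lambda>s. query_inv bad s \<and> iv s ''j'' = n)"
    by (rule achieves_seq)
  note achieves_loop_free_seq[OF _ this[unfolded s0_def]]
  note achieves_loop_free_seq[OF _ this]
  then show ?thesis
    unfolding pass_def by (auto simp: query_inv_def bad_def pass_cost_def elim!: achieves_weaken)
qed

section \<open>Sorting, reflecting and trying all centres\<close>

lemma image_swap:
  assumes "a < n" "b < (n::nat)"
  shows "(f(a := f b, b := f a)) ` {..<n} = f ` {..<n}"
proof -
  have "f q \<in> (f(a := f b, b := f a)) ` {..<n}" if "q < n" for q
    using that assms
    by (cases "q = a"; cases "q = b") (auto intro: rev_image_eqI[of a] rev_image_eqI[of b] rev_image_eqI[of q])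
  then show ?thesis using assms by auto
qed

text \<open>Up to index \<open>i\<close> the points are sorted, except that the sinking element \<open>j\<close> may be too small for
its predecessors. Once \<open>i\<close> has reached \<open>n\<close>, no element is sinking any more.\<close>

definition sort_inv :: "nat \<Rightarrow> point set \<Rightarrow> state \<Rightarrow> bool" where
  "sort_inv n K s \<longleftrightarrow> iv s ''n'' = n \<and> iv s ''j'' \<le> iv s ''i'' \<and> iv s ''i'' \<le> n \<and>
     (iv s ''i'' = n \<longrightarrow> iv s ''j'' = n) \<and>
     (\<forall>a b. a < b \<longrightarrow> b \<le> iv s ''i'' \<longrightarrow> b < n \<longrightarrow> b \<noteq> iv s ''j'' \<longrightarrow> ra s ''x'' a \<le> ra s ''x'' b) \<and>
     (\<lambda>a. (ra s ''x'' a, ra s ''y'' a)) ` {..<n} = K"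

lemma sort_step_inv:
  assumes inv: "sort_inv n K s" and lt: "iv s ''i'' < n"
  shows "sort_inv n K (eff N sort_step s) \<and>
    (n - iv (eff N sort_step s) ''i'') * (n + 1) + iv (eff N sort_step s) ''j''
      < (n - iv s ''i'') * (n + 1) + iv s ''j''"
proof -
  define i j X Y where "i = iv s ''i''" and "j = iv s ''j''" and "X = ra s ''x''" and "Y = ra s ''y''"
  define s' where "s' = eff N sort_step s"
  have n: "iv s ''n'' = n" and ji: "j \<le> i" and i: "i < n"
    and sorted: "\<And>a b. a < b \<Longrightarrow> b \<le> i \<Longrightarrow> b \<noteq> j \<Longrightarrow> X a \<le> X b"
    and K: "(\<lambda>a. (X a, Y a)) ` {..<n} = K"
    using inv lt by (auto simp: sort_inv_def i_def j_def X_def Y_def)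
  show ?thesis
  proof (cases "1 \<le> j \<and> \<not> X (j - 1) \<le> X j")
    case True
    have X': "ra s' ''x'' = X(j - 1 := X j, j := X (j - 1))"
      and Y': "ra s' ''y'' = Y(j - 1 := Y j, j := Y (j - 1))"
      and iv': "iv s' ''n'' = n" "iv s' ''i'' = i" "iv s' ''j'' = j - 1"
      using True n by (auto simp: s'_def sort_step_def X_def Y_def i_def j_def)
    have "ra s' ''x'' a \<le> ra s' ''x'' b" if ab: "a < b" "b \<le> i" "b \<noteq> j - 1" for a b
    proof (cases "b = j")
      case bj: True
      show ?thesis
        using True ab bj sorted[of a "j - 1"] ji by (cases "a = j - 1") (auto simp: X')
    next
      case bj: False
      then show ?thesis
        using True ab sorted[of "j - 1" b] sorted[of j b] sorted[of a b] ji by (auto simp: X')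
    qed
    moreover have "(\<lambda>a. (ra s' ''x'' a, ra s' ''y'' a)) ` {..<n} = K"
    proof -
      define f where "f a = (X a, Y a)" for a
      have "(\<lambda>a. (ra s' ''x'' a, ra s' ''y'' a)) = f(j - 1 := f j, j := f (j - 1))"
        using True by (auto simp: X' Y' f_def fun_eq_iff)
      moreover have "f ` {..<n} = K" using K by (simp add: f_def)
      moreover have "j - 1 < n" "j < n" using ji i by auto
      ultimately show ?thesis using image_swap[of "j - 1" n j f] by (simp only:)
    qed
    ultimately show ?thesis
      using True iv' ji i n unfolding sort_inv_def
      by (fold s'_def i_def j_def) auto
  next
    case False
    have s': "ra s' ''x'' = X" "ra s' ''y'' = Y" "iv s' ''n'' = n" "iv s' ''i'' = Suc i" "iv s' ''j'' = Suc i"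
      using False n by (auto simp: s'_def sort_step_def X_def Y_def i_def j_def)
    have "X a \<le> X b" if ab: "a < b" "b \<le> i" for a b
    proof (cases "b = j")
      case True
      then have "X (j - 1) \<le> X j" using False ab by auto
      moreover have "X a \<le> X (j - 1)" if "a \<noteq> j - 1" using that ab True sorted[of a "j - 1"] by simp
      ultimately show ?thesis using True by (cases "a = j - 1") auto
    qed (use sorted ab in blast)
    moreover have "(n - Suc i) * (n + 1) + Suc i < (n - i) * (n + 1) + j"
    proof -
      \<comment> \<open>The factor \<open>n + 1\<close> pays for resetting \<open>j\<close> to the next element, which raises \<open>j\<close> to at most \<open>n\<close>.\<close>
      have "(n - i) * (n + 1) = (n - Suc i) * (n + 1) + (n + 1)"
        using i by (metis Suc_diff_Suc add.commute mult_Suc)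
      then show ?thesis using i by simp
    qed
    ultimately show ?thesis
      using s' i n K unfolding sort_inv_def
      by (fold s'_def i_def j_def) (auto simp: le_Suc_eq)
  qed
qed

definition reflect_inv :: "nat \<Rightarrow> (nat \<Rightarrow> real) \<Rightarrow> (nat \<Rightarrow> real) \<Rightarrow> state \<Rightarrow> bool" where
  "reflect_inv n X Y s \<longleftrightarrow> iv s ''n'' = n \<and> iv s ''i'' \<le> n \<and>
     (\<forall>a<n. ra s ''x'' a = X a \<and> ra s ''y'' a = Y a) \<and>
     (\<forall>a<iv s ''i''. ra s ''x'' (n + a) = - X (n - 1 - a) \<and> ra s ''y'' (n + a) = - Y (n - 1 - a))"

lemma reflect_step_inv:
  assumes "reflect_inv n X Y s" "iv s ''i'' < n"
  shows "reflect_inv n X Y (eff N reflect_step s) \<and>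
    n - iv (eff N reflect_step s) ''i'' < n - iv s ''i''"
  using assms by (auto simp: reflect_inv_def reflect_step_def less_Suc_eq)

text \<open>The arrays after preprocessing: the sorted points, followed by their negatives in reversed order, which are sorted
again.\<close>

locale doubled_points = strictly_convex_plane +
  fixes n :: nat and X Y :: "nat \<Rightarrow> real" and r :: real
  assumes sorted: "i \<le> j \<Longrightarrow> j < n \<Longrightarrow> X i \<le> X j"
    and reflected: "i < n \<Longrightarrow> X (n + i) = - X (n - 1 - i)" "i < n \<Longrightarrow> Y (n + i) = - Y (n - 1 - i)"
begin

definition "site i = (X i, Y i)"

text \<open>Indices of the centres of the large and of the small disc in a solution.\<close>

definition "solves l j \<longleftrightarrow> (\<forall>i<n. N (site i - site l) \<le> r \<or> N (site i - site j) \<le> 1)"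

lemma upper_pass: "envelope_pass N n 0 X"
  by unfold_locales (simp add: sorted)

lemma lower_pass: "envelope_pass N n n X"
proof
  fix i j assume "i \<le> j" "j < n"
  then show "X (n + i) \<le> X (n + j)"
    using sorted[of "n - 1 - j" "n - 1 - i"] reflected(1)[of i] reflected(1)[of j] by simp
qed

lemma N_diff_commute: "N (a - b) = N (b - a)"
  using N_minus[of "a - b"] by simp

text \<open>The two one-sided verdicts together are exact: reflection maps the unit discs of the first half to those of the
second half and exchanges upper and lower boundaries.\<close>

lemma verdicts_agree:
  assumes up: "envelope_pass.verdict N n 0 X Y (site l) r j b"
    and low: "envelope_pass.verdict N n n X Y (- site l) r (n - 1 - j) b'"
    and j: "j < n"
  shows "b + b' = 0 \<longleftrightarrow> solves l j"
proof -
  interpret up: envelope_pass N n 0 X Y "site l" r by (rule upper_pass)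
  interpret low: envelope_pass N n n X Y "- site l" r by (rule lower_pass)
  have up_pt: "up.pt i = site i" for i by (simp add: up.pt_def site_def)
  have low_pt: "low.pt i = - site (n - 1 - i)" if "i < n" for i
    using that reflected by (simp add: low.pt_def site_def)
  have low_pt': "low.pt (n - 1 - i) = - site i" if "i < n" for i
    using that low_pt[of "n - 1 - i"] by simp
  have up_far: "up.far i \<longleftrightarrow> r < N (site i - site l)" for i by (simp add: up.far_def up_pt)
  have low_far: "low.far (n - 1 - i) \<longleftrightarrow> up.far i" if "i < n" for i
    using low_pt'[OF that] N_diff_commute by (simp add: low.far_def up_far)
  have flip: "(\<forall>i<n. P i) \<longleftrightarrow> (\<forall>i<n. P (n - 1 - i))" for P
  proof
    assume h: "\<forall>i<n. P (n - 1 - i)"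
    show "\<forall>i<n. P i"
    proof (intro allI impI)
      fix i assume "i < n"
      then show "P i" using h[rule_format, of "n - 1 - i"] by simp
    qed
  qed auto
  have solves: "solves l j \<longleftrightarrow> (\<forall>i<n. up.far i \<longrightarrow> N (site j - site i) \<le> 1)"
    unfolding solves_def up_far by (metis N_diff_commute not_less)
  show ?thesis
  proof
    assume "b + b' = 0"
    then have bb: "b = 0" "b' = 0" by auto
    have "N (site j - site i) \<le> 1" if i: "i < n" "up.far i" for i
    proof (rule between_boundaries)
      show "\<bar>fst (site j) - fst (site i)\<bar> \<le> fst tip" "snd (site j) \<le> boundary (site i) (fst (site j))"
        using up i bb(1) by (auto simp: up.verdict_def up_pt)
      have "n - 1 - i < n" "low.far (n - 1 - i)" using i low_far by auto
      then have "snd (low.pt (n - 1 - j)) \<le> boundary (low.pt (n - 1 - i)) (fst (low.pt (n - 1 - j)))"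
        using low bb(2) unfolding low.verdict_def by blast
      then show "- snd (site j) \<le> boundary (- site i) (- fst (site j))"
        using low_pt' i j by simp
    qed
    then show "solves l j" unfolding solves by blast
  next
    assume s: "solves l j"
    then have "b = 0" using up unfolding up.verdict_def up_pt solves by blast
    moreover have "\<forall>i<n. low.far i \<longrightarrow> N (low.pt (n - 1 - j) - low.pt i) \<le> 1"
    proof (subst flip, intro allI impI)
      fix i assume "i < n" "low.far (n - 1 - i)"
      then have "N (site j - site i) \<le> 1" using s low_far unfolding solves by blast
      then show "N (low.pt (n - 1 - j) - low.pt (n - 1 - i)) \<le> 1"
        using low_pt' \<open>i < n\<close> j N_diff_commute by simp
    qed
    then have "b' = 0" using low unfolding low.verdict_def by blast
    ultimately show "b + b' = 0" by simp
  qed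
qed

text \<open>The output variables are correct with respect to the pairs in \<open>M\<close>, the ones examined so far.\<close>

definition outcome :: "(nat \<times> nat) set \<Rightarrow> state \<Rightarrow> bool" where
  "outcome M s \<longleftrightarrow>
     (iv s ''found'' = 0 \<and> (\<forall>a b. (a, b) \<in> M \<longrightarrow> \<not> solves a b)) \<or>
     (iv s ''found'' = 1 \<and> (\<exists>a<n. \<exists>b<n. solves a b \<and>
        (rv s ''px'', rv s ''py'') = site a \<and> (rv s ''qx'', rv s ''qy'') = site b))"

definition preprocessed :: "state \<Rightarrow> bool" where
  "preprocessed s \<longleftrightarrow> iv s ''n'' = n \<and> ra s ''x'' = X \<and> ra s ''y'' = Y \<and>
     rv s ''r'' = r \<and> (rv s ''w'', rv s ''e'') = tip"

definition scan_inv :: "nat \<Rightarrow> (nat \<Rightarrow> nat) \<Rightarrow> state \<Rightarrow> bool" where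
  "scan_inv l bad s \<longleftrightarrow> preprocessed s \<and> iv s ''l'' = l \<and> ia s ''bad'' = bad \<and> iv s ''j'' \<le> n \<and>
     outcome ({..<l} \<times> {..<n} \<union> {l} \<times> {..<iv s ''j''}) s"

lemma scan_step_inv:
  assumes inv: "scan_inv l bad s" and lt: "iv s ''j'' < n" and l: "l < n"
    and bad: "\<And>j. j < n \<Longrightarrow> bad j + bad (n + (n - 1 - j)) = 0 \<longleftrightarrow> solves l j"
  shows "scan_inv l bad (eff N scan_step s) \<and> n - iv (eff N scan_step s) ''j'' < n - iv s ''j''"
proof -
  define j where "j = iv s ''j''"
  have j: "j < n" using lt by (simp add: j_def)
  have test: "bval N (ILe (IAdd (IArr ''bad'' (IVar ''j''))
      (IArr ''bad'' (IAdd (IVar ''n'') (ISub (pred (IVar ''n'')) (IVar ''j''))))) (ICon 0)) s \<longleftrightarrow> solves l j"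
    using inv bad[OF j] by (simp add: scan_inv_def preprocessed_def j_def)
  have split: "{..<l} \<times> {..<n} \<union> {l} \<times> {..<Suc j} = insert (l, j) ({..<l} \<times> {..<n} \<union> {l} \<times> {..<j})"
    by auto
  show ?thesis
  proof (cases "solves l j")
    case True
    then show ?thesis using inv j l test
      by (auto simp: scan_step_def scan_inv_def preprocessed_def outcome_def site_def j_def)
  next
    case False
    then have "eff N scan_step s = s\<lparr>iv := (iv s)(''j'' := Suc j)\<rparr>"
      using test by (simp only: scan_step_def eff.simps if_False) (simp add: j_def)
    then show ?thesis using inv j False
      unfolding scan_inv_def by (simp add: split preprocessed_def outcome_def j_def[symmetric])
  qed
qed

end

lemma writes_pass: "writes pass = {''i'', ''k'', ''j'', ''u'', ''v'', ''m'', ''ix'', ''iy'', ''t'',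
   ''sx'', ''sy'', ''st'', ''f'', ''g'', ''a'', ''b'', ''bad''}"
  by (auto simp: pass_def build_step_def query_step_def writes_find_threshold load_def push_def)

definition centre_cost :: "nat \<Rightarrow> nat" where
  "centre_cost n = 34 + 2 * pass_cost n + (6 + max_cost scan_step) * (n + 1)"

context doubled_points begin

definition centre_inv :: "state \<Rightarrow> bool" where
  "centre_inv s \<longleftrightarrow> preprocessed s \<and> iv s ''l'' \<le> n \<and> outcome ({..<iv s ''l''} \<times> {..<n}) s"

lemma scan_correct:
  assumes "preprocessed s" "iv s ''l'' = l" "l < n" "outcome ({..<l} \<times> {..<n}) s"
    and "\<And>j. j < n \<Longrightarrow> ia s ''bad'' j + ia s ''bad'' (n + (n - 1 - j)) = 0 \<longleftrightarrow> solves l j"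
  shows "achieves N (seqs [ISet ''j'' (ICon 0), While (below ''j'' ''n'') scan_step, succ ''l'']) s
    (8 + (6 + max_cost scan_step) * (n + 1)) (\<lambda>s'. centre_inv s' \<and> iv s' ''l'' = Suc l)"
proof -
  define s1 where "s1 = eff N (ISet ''j'' (ICon 0)) s"
  define bad where "bad = ia s ''bad''"
  have s1: "scan_inv l bad s1"
    using assms(1-4) by (simp add: scan_inv_def s1_def preprocessed_def outcome_def bad_def)
  have "achieves N (While (below ''j'' ''n'') scan_step) s1 ((6 + max_cost scan_step) * (n + 1))
     (\<lambda>s. scan_inv l bad s \<and> iv s ''j'' = n)"
  proof (rule achieves_weaken[OF achieves_while[where I = "scan_inv l bad" and B = "max_cost scan_step"
        and \<mu> = "\<lambda>s. n - iv s ''j''"]])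
    fix s assume "scan_inv l bad s" "bval N (below ''j'' ''n'') s"
    then show "achieves N scan_step s (max_cost scan_step)
        (\<lambda>s'. scan_inv l bad s' \<and> n - iv s' ''j'' < n - iv s ''j'')"
      using assms(3,5)
      by (intro achieves_loop_free loop_free_steps scan_step_inv) (auto simp: scan_inv_def preprocessed_def bad_def)
  next
    show "(1 + bcost (below ''j'' ''n'') + max_cost scan_step) * (n - iv s1 ''j'' + 1)
        \<le> (6 + max_cost scan_step) * (n + 1)"
      by (intro mult_le_mono) simp_all
  qed (use s1 in \<open>auto simp: scan_inv_def preprocessed_def\<close>)
  moreover have "achieves N (succ ''l'') s 4 (\<lambda>s'. centre_inv s' \<and> iv s' ''l'' = Suc l)"
    if "scan_inv l bad s \<and> iv s ''j'' = n" for s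
  proof -
    have "{..<Suc l} \<times> {..<n} = {..<l} \<times> {..<n} \<union> {l} \<times> {..<n}" by auto
    then have "outcome ({..<Suc l} \<times> {..<n}) s" using that unfolding scan_inv_def by (elim conjE) (simp only:)
    then have h: "centre_inv (eff N (succ ''l'') s) \<and> iv (eff N (succ ''l'') s) ''l'' = Suc l"
      using that assms(3) by (simp add: scan_inv_def centre_inv_def preprocessed_def outcome_def)
    have "achieves N (succ ''l'') s (max_cost (succ ''l'')) (\<lambda>s'. centre_inv s' \<and> iv s' ''l'' = Suc l)"
      by (rule achieves_loop_free) (simp, rule h)
    then show ?thesis by (rule achieves_weaken) simp_all
  qed
  ultimately have "achieves N (Seq (While (below ''j'' ''n'') scan_step) (succ ''l'')) s1
      (1 + (6 + max_cost scan_step) * (n + 1) + 4) (\<lambda>s'. centre_inv s' \<and> iv s' ''l'' = Suc l)"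
    by (rule achieves_seq)
  note rest = this[unfolded s1_def]
  have "seqs [c1, c2, c3] = Seq c1 (Seq c2 c3)" for c1 c2 c3 by simp
  then show ?thesis
    by (simp only:) (rule achieves_weaken[OF achieves_loop_free_seq[OF _ rest]], simp_all)
qed

lemma centre_correct:
  assumes inv: "centre_inv s" and lt: "iv s ''l'' < n"
  shows "achieves N centre_step s (centre_cost n) (\<lambda>s'. centre_inv s' \<and> n - iv s' ''l'' < n - iv s ''l'')"
proof -
  define l where "l = iv s ''l''"
  interpret up: envelope_pass N n 0 X Y "site l" r by (rule upper_pass)
  interpret low: envelope_pass N n n X Y "- site l" r by (rule lower_pass)
  define kept where "kept s' \<longleftrightarrow> preprocessed s' \<and> iv s' ''l'' = l \<and> outcome ({..<l} \<times> {..<n}) s'" for s' :: state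
  have kept_frame: "kept s'"
    if "\<forall>x. x \<notin> writes pass \<longrightarrow> iv s' x = iv s0 x \<and> rv s' x = rv s0 x \<and> ia s' x = ia s0 x \<and> ra s' x = ra s0 x"
      and "kept s0" for s0 s' :: state
    using that unfolding writes_pass kept_def preprocessed_def outcome_def by simp
  have l: "l < n" using lt by (simp add: l_def)
  define A where "A = seqs [RSet ''c'' (RArr ''x'' (IVar ''l'')), RSet ''d'' (RArr ''y'' (IVar ''l'')), ISet ''o'' (ICon 0)]"
  define B where "B = seqs [RSet ''c'' (RSub (RCon 0) (RVar ''c'')), RSet ''d'' (RSub (RCon 0) (RVar ''d'')),
       ISet ''o'' (IVar ''n'')]"
  define C where "C = seqs [ISet ''j'' (ICon 0), While (below ''j'' ''n'') scan_step, succ ''l'']"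
  define Q where "Q s' \<longleftrightarrow> centre_inv s' \<and> iv s' ''l'' = Suc l" for s' :: state
  \<comment> \<open>The statements are numbered by the first of the five parts of the step that they cover, and are proved from the last one backwards.\<close>
  have 5: "achieves N C s (8 + (6 + max_cost scan_step) * (n + 1)) Q"
    if kept: "kept s" and up_ok: "\<forall>j<n. up.verdict j (ia s ''bad'' j)"
      and low_ok: "\<forall>j<n. low.verdict j (ia s ''bad'' (n + j))" for s
    unfolding C_def Q_def
  proof (rule scan_correct)
    show "ia s ''bad'' j + ia s ''bad'' (n + (n - 1 - j)) = 0 \<longleftrightarrow> solves l j" if "j < n" for j
    proof (rule verdicts_agree[OF _ _ \<open>j < n\<close>])
      show "up.verdict j (ia s ''bad'' j)" using up_ok \<open>j < n\<close> by simp
      have "n - 1 - j < n" using \<open>j < n\<close> by simp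
      then show "low.verdict (n - 1 - j) (ia s ''bad'' (n + (n - 1 - j)))" using low_ok by blast
    qed
  qed (use kept l in \<open>auto simp: kept_def\<close>)
  have 4: "achieves N (Seq pass C) s (1 + pass_cost n + (8 + (6 + max_cost scan_step) * (n + 1))) Q"
    if "kept s" "low.env s" "\<forall>j<n. up.verdict j (ia s ''bad'' j)" for s
  proof (rule achieves_seq[OF achieves_frame[OF low.pass_correct[OF that(2)]]])
    fix s' :: state
    assume s': "((\<forall>j<n. low.verdict j (ia s' ''bad'' (n + j))) \<and>
          (\<forall>q. q < n \<or> n + n \<le> q \<longrightarrow> ia s' ''bad'' q = ia s ''bad'' q)) \<and>
         (\<forall>x. x \<notin> writes pass \<longrightarrow> iv s' x = iv s x \<and> rv s' x = rv s x \<and> ia s' x = ia s x \<and> ra s' x = ra s x)"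
    then have "kept s'" using kept_frame that(1) by blast
    then show "achieves N C s' (8 + (6 + max_cost scan_step) * (n + 1)) Q"
      using s' that(3) by (intro 5) auto
  qed
  have 3: "achieves N (Seq B (Seq pass C)) s
      (1 + 12 + (1 + pass_cost n + (8 + (6 + max_cost scan_step) * (n + 1)))) Q"
    if "kept s" "(rv s ''c'', rv s ''d'') = site l" "\<forall>j<n. up.verdict j (ia s ''bad'' j)" for s
  proof -
    have "kept (eff N B s)" "low.env (eff N B s)" "\<forall>j<n. up.verdict j (ia (eff N B s) ''bad'' j)"
      using that by (auto simp: B_def kept_def preprocessed_def outcome_def low.env_def prod_eq_iff)
    from achieves_loop_free_seq[OF _ 4[OF this]] show ?thesis by (simp add: B_def)
  qed
  have 2: "achieves N (Seq pass (Seq B (Seq pass C))) s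
      (1 + pass_cost n + (1 + 12 + (1 + pass_cost n + (8 + (6 + max_cost scan_step) * (n + 1))))) Q"
    if "kept s" "up.env s" for s
  proof (rule achieves_seq[OF achieves_frame[OF up.pass_correct[OF that(2)]]])
    fix s' :: state
    assume s': "((\<forall>j<n. up.verdict j (ia s' ''bad'' (0 + j))) \<and>
          (\<forall>q. q < 0 \<or> 0 + n \<le> q \<longrightarrow> ia s' ''bad'' q = ia s ''bad'' q)) \<and>
         (\<forall>x. x \<notin> writes pass \<longrightarrow> iv s' x = iv s x \<and> rv s' x = rv s x \<and> ia s' x = ia s x \<and> ra s' x = ra s x)"
    then have "kept s'" using kept_frame that(1) by blast
    moreover have "(rv s' ''c'', rv s' ''d'') = site l"
      using s' that(2) by (simp add: writes_pass up.env_def)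
    ultimately show "achieves N (Seq B (Seq pass C)) s'
      (1 + 12 + (1 + pass_cost n + (8 + (6 + max_cost scan_step) * (n + 1)))) Q"
      using s' by (intro 3) auto
  qed
  have "kept (eff N A s)" "up.env (eff N A s)"
    using inv unfolding A_def kept_def centre_inv_def preprocessed_def outcome_def up.env_def
    by (simp_all add: site_def l_def)
  from achieves_loop_free_seq[OF _ 2[OF this]]
  have "achieves N centre_step s (1 + max_cost A + (1 + pass_cost n + (1 + 12 + (1 + pass_cost n +
      (8 + (6 + max_cost scan_step) * (n + 1)))))) Q"
    by (simp add: A_def B_def C_def centre_step_def)
  then show ?thesis
    by (rule achieves_weaken) (use l in \<open>auto simp: A_def centre_cost_def Q_def l_def\<close>)
qed

end

definition two_center_cost :: "nat \<Rightarrow> nat" where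
  "two_center_cost n = 7 + (6 + max_cost sort_step) * (n * (n + 1) + 1)
     + (6 + max_cost reflect_step) * (n + 1) + max_cost find_tip + (6 + centre_cost n) * (n + 1)"

lemma sort_correct:
  assumes "iv s ''n'' = n" "iv s ''i'' = 0" "iv s ''j'' = 0"
  shows "achieves N (While (below ''i'' ''n'') sort_step) s ((6 + max_cost sort_step) * (n * (n + 1) + 1))
    (\<lambda>s'. (\<forall>a b. a \<le> b \<longrightarrow> b < n \<longrightarrow> ra s' ''x'' a \<le> ra s' ''x'' b) \<and>
      (\<lambda>a. (ra s' ''x'' a, ra s' ''y'' a)) ` {..<n} = (\<lambda>a. (ra s ''x'' a, ra s ''y'' a)) ` {..<n})"
proof -
  define K where "K = (\<lambda>a. (ra s ''x'' a, ra s ''y'' a)) ` {..<n}"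
  have "achieves N (While (below ''i'' ''n'') sort_step) s ((6 + max_cost sort_step) * (n * (n + 1) + 1))
    (\<lambda>s. sort_inv n K s \<and> iv s ''i'' = n)"
  proof (rule achieves_weaken[OF achieves_while[where I = "sort_inv n K" and B = "max_cost sort_step"
        and \<mu> = "\<lambda>s. (n - iv s ''i'') * (n + 1) + iv s ''j''"]])
    fix s assume "sort_inv n K s" "bval N (below ''i'' ''n'') s"
    then show "achieves N sort_step s (max_cost sort_step) (\<lambda>s'. sort_inv n K s' \<and>
        (n - iv s' ''i'') * (n + 1) + iv s' ''j'' < (n - iv s ''i'') * (n + 1) + iv s ''j'')"
      by (intro achieves_loop_free loop_free_steps sort_step_inv) (auto simp: sort_inv_def)
  next
    show "(1 + bcost (below ''i'' ''n'') + max_cost sort_step) * ((n - iv s ''i'') * (n + 1) + iv s ''j'' + 1)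
        \<le> (6 + max_cost sort_step) * (n * (n + 1) + 1)"
      using assms by (intro mult_le_mono) simp_all
  qed (use assms in \<open>auto simp: sort_inv_def K_def\<close>)
  then show ?thesis
  proof (rule achieves_weaken)
    fix s' assume s': "sort_inv n K s' \<and> iv s' ''i'' = n"
    have "ra s' ''x'' a \<le> ra s' ''x'' b" if "a \<le> b" "b < n" for a b
      using s' that by (cases "a = b") (auto simp: sort_inv_def)
    then show "(\<forall>a b. a \<le> b \<longrightarrow> b < n \<longrightarrow> ra s' ''x'' a \<le> ra s' ''x'' b) \<and>
      (\<lambda>a. (ra s' ''x'' a, ra s' ''y'' a)) ` {..<n} = (\<lambda>a. (ra s ''x'' a, ra s ''y'' a)) ` {..<n}"
      using s' by (simp add: sort_inv_def K_def)
  qed simp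
qed

lemma reflect_correct:
  assumes "iv s ''n'' = n" "iv s ''i'' = 0"
  shows "achieves N (While (below ''i'' ''n'') reflect_step) s ((6 + max_cost reflect_step) * (n + 1))
    (\<lambda>s'. reflect_inv n (ra s ''x'') (ra s ''y'') s' \<and> iv s' ''i'' = n)"
proof (rule achieves_weaken[OF achieves_while[where I = "reflect_inv n (ra s ''x'') (ra s ''y'')"
      and B = "max_cost reflect_step" and \<mu> = "\<lambda>s. n - iv s ''i''"]])
  fix s1 assume "reflect_inv n (ra s ''x'') (ra s ''y'') s1" "bval N (below ''i'' ''n'') s1"
  then show "achieves N reflect_step s1 (max_cost reflect_step)
      (\<lambda>s'. reflect_inv n (ra s ''x'') (ra s ''y'') s' \<and> n - iv s' ''i'' < n - iv s1 ''i'')"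
    by (intro achieves_loop_free loop_free_steps reflect_step_inv) (auto simp: reflect_inv_def)
next
  show "(1 + bcost (below ''i'' ''n'') + max_cost reflect_step) * (n - iv s ''i'' + 1)
      \<le> (6 + max_cost reflect_step) * (n + 1)"
    by (intro mult_le_mono) simp_all
qed (use assms in \<open>auto simp: reflect_inv_def\<close>)

lemma writes_steps:
  "writes sort_step = {''u'', ''v'', ''x'', ''y'', ''i'', ''j''}"
  "writes reflect_step = {''x'', ''y'', ''i''}"
  "writes find_tip = {''m'', ''ix'', ''iy'', ''w'', ''e''}"
  by (auto simp: sort_step_def reflect_step_def find_tip_def)

context doubled_points begin

lemma centres_correct:
  assumes "preprocessed s" "iv s ''l'' = 0" "iv s ''found'' = 0"
  shows "achieves N (While (below ''l'' ''n'') centre_step) s ((6 + centre_cost n) * (n + 1))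
    (outcome ({..<n} \<times> {..<n}))"
proof (rule achieves_weaken[OF achieves_while[where I = centre_inv and B = "centre_cost n"
      and \<mu> = "\<lambda>s. n - iv s ''l''"]])
  fix s assume "centre_inv s" "bval N (below ''l'' ''n'') s"
  then show "achieves N centre_step s (centre_cost n) (\<lambda>s'. centre_inv s' \<and> n - iv s' ''l'' < n - iv s ''l'')"
    by (intro centre_correct) (auto simp: centre_inv_def preprocessed_def)
next
  show "(1 + bcost (below ''l'' ''n'') + centre_cost n) * (n - iv s ''l'' + 1) \<le> (6 + centre_cost n) * (n + 1)"
    by (intro mult_le_mono) simp_all
next
  fix s' assume "centre_inv s' \<and> \<not> bval N (below ''l'' ''n'') s'"
  then have "iv s' ''l'' = n" "outcome ({..<iv s' ''l''} \<times> {..<n}) s'"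
    by (auto simp: centre_inv_def preprocessed_def)
  then show "outcome ({..<n} \<times> {..<n}) s'" by simp
qed (use assms in \<open>simp add: centre_inv_def outcome_def\<close>)

lemma solves_iff:
  "a < n \<Longrightarrow> b < n \<Longrightarrow> two_center_solution N (site ` {..<n}) r (site a) (site b) \<longleftrightarrow> solves a b"
  by (auto simp: two_center_solution_def disc_def solves_def)

lemma outcome_output:
  assumes "outcome ({..<n} \<times> {..<n}) s"
  shows "two_center_output N (site ` {..<n}) r s"
proof -
  have unsolvable: "\<not> (\<exists>p q. two_center_solution N (site ` {..<n}) r p q)"
    if "\<forall>a b. (a, b) \<in> {..<n} \<times> {..<n} \<longrightarrow> \<not> solves a b"
  proof
    assume "\<exists>p q. two_center_solution N (site ` {..<n}) r p q"
    then obtain a b where "a < n" "b < n" "two_center_solution N (site ` {..<n}) r (site a) (site b)"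
      by (auto simp: two_center_solution_def)
    then show False using that solves_iff by auto
  qed
  show ?thesis
  proof (cases "iv s ''found'' = 0")
    case True
    then show ?thesis using assms unsolvable unfolding outcome_def two_center_output_def by simp
  next
    case False
    then obtain a b where "iv s ''found'' = 1" "a < n" "b < n" "solves a b"
      "(rv s ''px'', rv s ''py'') = site a" "(rv s ''qx'', rv s ''qy'') = site b"
      using assms unfolding outcome_def by metis
    then have sol:
      "two_center_solution N (site ` {..<n}) r (rv s ''px'', rv s ''py'') (rv s ''qx'', rv s ''qy'')"
      using solves_iff by simp
    then have "\<exists>p q. two_center_solution N (site ` {..<n}) r p q" by blast
    then show ?thesis using sol \<open>iv s ''found'' = 1\<close> unfolding two_center_output_def by (simp only: if_True simp_thms)
  qed
qed

end

lemma (in strictly_convex_plane) two_center_program_correct: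
  assumes K: "set xs = K" "distinct xs"
  shows "achieves N two_center_program (two_center_input xs r) (two_center_cost (card K)) (two_center_output N K r)"
proof -
  define n where "n = length xs"
  define s0 where "s0 = two_center_input xs r"
  have n: "card K = n" using K distinct_card n_def by blast
  define init where "init s \<longleftrightarrow> iv s ''n'' = n \<and> iv s ''l'' = 0 \<and> iv s ''found'' = 0 \<and> rv s ''r'' = r" for s :: state
  define arranged where "arranged s \<longleftrightarrow> (\<forall>a b. a \<le> b \<longrightarrow> b < n \<longrightarrow> ra s ''x'' a \<le> ra s ''x'' b) \<and>
      (\<lambda>a. (ra s ''x'' a, ra s ''y'' a)) ` {..<n} = K" for s :: state
  have s0: "init s0" "iv s0 ''n'' = n" "iv s0 ''i'' = 0" "iv s0 ''j'' = 0"
    by (simp_all add: s0_def two_center_input_def init_def n_def)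
  have K0: "(\<lambda>a. (ra s0 ''x'' a, ra s0 ''y'' a)) ` {..<n} = K"
    using K(1) by (force simp: s0_def two_center_input_def n_def in_set_conv_nth image_iff)
  define final where "final = While (below ''l'' ''n'') centre_step"
  have 4: "achieves N (Seq find_tip final) s (1 + max_cost find_tip + (6 + centre_cost n) * (n + 1))
      (two_center_output N K r)"
    if init: "init s" and "reflect_inv n X Y s" "iv s ''i'' = n"
      and X: "\<And>a b. a \<le> b \<Longrightarrow> b < n \<Longrightarrow> X a \<le> X b" and KX: "(\<lambda>a. (X a, Y a)) ` {..<n} = K" for s X Y
  proof (rule achieves_loop_free_seq[OF loop_free_steps(6)])
    define s1 where "s1 = eff N find_tip s"
    have s1: "ra s1 ''x'' = ra s ''x''" "ra s1 ''y'' = ra s ''y''" "init s1"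
      using init unfolding s1_def init_def by (simp_all add: eff_frame loop_free_steps writes_steps)
    have tip: "(rv s1 ''w'', rv s1 ''e'') = tip" by (simp add: s1_def find_tip_eff)
    have refl: "ra s ''x'' a = X a" "ra s ''y'' a = Y a"
        "ra s ''x'' (n + a) = - X (n - 1 - a)" "ra s ''y'' (n + a) = - Y (n - 1 - a)" if "a < n" for a
      using that \<open>reflect_inv n X Y s\<close> \<open>iv s ''i'' = n\<close> by (auto simp: reflect_inv_def)
    interpret doubled_points N n "ra s ''x''" "ra s ''y''" r
      by unfold_locales (use refl X in auto)
    have "site ` {..<n} = K" unfolding KX[symmetric] by (intro image_cong) (simp_all add: site_def refl)
    then have result: "two_center_output N K r s'" if "outcome ({..<n} \<times> {..<n}) s'" for s'
      using outcome_output[OF that] by simp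
    show "achieves N final s1 ((6 + centre_cost n) * (n + 1)) (two_center_output N K r)"
      using s1 tip unfolding final_def
      by (intro achieves_weaken[OF centres_correct _ result]) (simp_all add: preprocessed_def init_def)
  qed
  define reflect where "reflect = While (below ''i'' ''n'') reflect_step"
  have 3: "achieves N (Seq reflect (Seq find_tip final)) s (1 + (6 + max_cost reflect_step) * (n + 1) +
      (1 + max_cost find_tip + (6 + centre_cost n) * (n + 1))) (two_center_output N K r)"
    if "init s" "arranged s" "iv s ''i'' = 0" for s
  proof (rule achieves_seq[OF achieves_frame[OF reflect_correct[OF _ that(3), of n, folded reflect_def]]])
    show "iv s ''n'' = n" using that by (simp add: init_def)
    fix s' :: state
    assume s': "(reflect_inv n (ra s ''x'') (ra s ''y'') s' \<and> iv s' ''i'' = n) \<and> (\<forall>x. x \<notin> writes reflect \<longrightarrow>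
      iv s' x = iv s x \<and> rv s' x = rv s x \<and> ia s' x = ia s x \<and> ra s' x = ra s x)"
    then have "init s'" using that(1) by (simp add: reflect_def writes_steps init_def)
    then show "achieves N (Seq find_tip final) s' (1 + max_cost find_tip + (6 + centre_cost n) * (n + 1))
      (two_center_output N K r)"
      using s' that(2) by (intro 4[of s' "ra s ''x''" "ra s ''y''"]) (auto simp: arranged_def)
  qed
  define sort where "sort = While (below ''i'' ''n'') sort_step"
  have "achieves N (Seq sort (Seq (ISet ''i'' (ICon 0)) (Seq reflect (Seq find_tip final)))) s0
      (1 + (6 + max_cost sort_step) * (n * (n + 1) + 1) + (1 + 2 + (1 + (6 + max_cost reflect_step) * (n + 1) +
      (1 + max_cost find_tip + (6 + centre_cost n) * (n + 1))))) (two_center_output N K r)"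
  proof (rule achieves_seq[OF achieves_frame[OF sort_correct[OF s0(2-4), folded sort_def]]])
    fix s' :: state
    assume s': "((\<forall>a b. a \<le> b \<longrightarrow> b < n \<longrightarrow> ra s' ''x'' a \<le> ra s' ''x'' b) \<and>
        (\<lambda>a. (ra s' ''x'' a, ra s' ''y'' a)) ` {..<n} = (\<lambda>a. (ra s0 ''x'' a, ra s0 ''y'' a)) ` {..<n}) \<and>
        (\<forall>x. x \<notin> writes sort \<longrightarrow> iv s' x = iv s0 x \<and> rv s' x = rv s0 x \<and> ia s' x = ia s0 x \<and> ra s' x = ra s0 x)"
    define s1 where "s1 = eff N (ISet ''i'' (ICon 0)) s'"
    have "init s1" "arranged s1" "iv s1 ''i'' = 0"
      using s' s0(1) K0 by (auto simp: s1_def init_def arranged_def sort_def writes_steps)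
    from achieves_loop_free_seq[OF _ 3[OF this, unfolded s1_def]]
    show "achieves N (Seq (ISet ''i'' (ICon 0)) (Seq reflect (Seq find_tip final))) s'
      (1 + 2 + (1 + (6 + max_cost reflect_step) * (n + 1) +
      (1 + max_cost find_tip + (6 + centre_cost n) * (n + 1)))) (two_center_output N K r)"
      by simp
  qed
  moreover have "two_center_program =
      Seq sort (Seq (ISet ''i'' (ICon 0)) (Seq reflect (Seq find_tip final)))"
    by (simp add: two_center_program_def sort_def reflect_def final_def)
  ultimately show ?thesis
    unfolding n s0_def[symmetric] by (simp only:) (erule achieves_weaken, simp_all add: two_center_cost_def)
qed

lemma two_center_cost_bound: "\<exists>C. \<forall>n. two_center_cost n \<le> C * (n + 1) ^ 2"
proof -
  define P where "P = 22 + 2 * max_cost build_step + 12 + 2 * max_cost query_step"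
  define Q where "Q = 34 + 2 * P + (6 + max_cost scan_step)"
  have P: "pass_cost n \<le> P * (n + 1)" for n
    by (simp add: pass_cost_def P_def algebra_simps)
  have Q: "6 + centre_cost n \<le> (6 + Q) * (n + 1)" for n
    using P[of n] by (simp add: centre_cost_def Q_def algebra_simps)
  define C where "C = 7 + (6 + max_cost sort_step) + (6 + max_cost reflect_step) + max_cost find_tip + (6 + Q)"
  have "two_center_cost n \<le> C * (n + 1) ^ 2" for n
  proof -
    have sq: "1 \<le> (n + 1) ^ 2" "n + 1 \<le> (n + 1) ^ 2" "n * (n + 1) + 1 \<le> (n + 1) ^ 2"
      by (simp_all add: power2_eq_square)
    have "(6 + centre_cost n) * (n + 1) \<le> (6 + Q) * (n + 1) ^ 2"
      using mult_le_mono1[OF Q[of n], of "n + 1"] by (simp add: power2_eq_square algebra_simps)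
    moreover have "(6 + max_cost sort_step) * (n * (n + 1) + 1) \<le> (6 + max_cost sort_step) * (n + 1) ^ 2"
      "(6 + max_cost reflect_step) * (n + 1) \<le> (6 + max_cost reflect_step) * (n + 1) ^ 2"
      "max_cost find_tip * 1 \<le> max_cost find_tip * (n + 1) ^ 2" "7 * 1 \<le> 7 * (n + 1) ^ 2"
      using sq by (intro mult_le_mono2; simp)+
    moreover have "C * (n + 1) ^ 2 = 7 * (n + 1) ^ 2 + (6 + max_cost sort_step) * (n + 1) ^ 2
        + (6 + max_cost reflect_step) * (n + 1) ^ 2 + max_cost find_tip * (n + 1) ^ 2 + (6 + Q) * (n + 1) ^ 2"
      unfolding C_def by (simp only: add_mult_distrib)
    ultimately show ?thesis unfolding two_center_cost_def by linarith
  qed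
  then show ?thesis by blast
qed

theorem theorem6:
  fixes N :: "real \<times> real \<Rightarrow> real"
  assumes "strictly_convex_plane N"
  shows "\<exists>prog T. solves_two_center_within N prog T \<and> (\<lambda>n. real (T n)) \<in> O(\<lambda>n. real n ^ 2)"
proof (intro exI conjI)
  interpret strictly_convex_plane N by (rule assms)
  show "solves_two_center_within N two_center_program two_center_cost"
    using two_center_program_correct unfolding solves_two_center_within_def achieves_def by blast
  obtain C where C: "\<And>n. two_center_cost n \<le> C * (n + 1) ^ 2"
    using two_center_cost_bound by blast
  show "(\<lambda>n. real (two_center_cost n)) \<in> O(\<lambda>n. real n ^ 2)"
  proof (rule bigoI[where c = "4 * real C"])
    show "\<forall>\<^sub>F n in sequentially. norm (real (two_center_cost n)) \<le> 4 * real C * norm (real n ^ 2)"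
      using eventually_ge_at_top[of 1]
    proof eventually_elim
      case (elim n)
      have "(n + 1) ^ 2 \<le> (2 * n) ^ 2" using elim by (intro power_mono) auto
      then have "C * (n + 1) ^ 2 \<le> C * (4 * n ^ 2)" by (intro mult_le_mono2) (simp add: power_mult_distrib)
      with C[of n] have "two_center_cost n \<le> C * (4 * n ^ 2)" by (rule order_trans)
      then have "two_center_cost n \<le> 4 * C * n ^ 2" by (simp only: ac_simps)
      then have "real (two_center_cost n) \<le> real (4 * C * n ^ 2)" by (simp only: of_nat_le_iff)
      then show ?case by simp
    qed
  qed
qed

end
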